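(* Let $P\subset\mathbb{R}^n$ be a convex polytope and $\ell$ a linear function nonconstant on every edge, such that for every vertex $v$ both $F^-(v)$ and $F^+(v)$ are faces of $P$ and $O^-$ is a stratification. Then for all vertices $v\preceq w$, the Chow polynomial $\mathrm{H}_{vw}$ of the vertex poset with respect to $\kappa$ equals the $h$-polynomial of the dual polytope $\mathrm{CH}_\ell\big(F^+(v)\cap F^-(w)\big)^*$, i.e. $\mathrm{H}_{vw}(x)=\sum_{i=0}^{d} f_i\big(\mathrm{CH}_\ell(F^+(v)\cap F^-(w))\big)(x-1)^i$, where $d=\dim \mathrm{CH}_\ell(F^+(v)\cap F^-(w))$ and $f_i$ denotes the number of $i$-dimensional faces.
   Context: $O^\pm(v)$: union of relative interiors of faces $G$ of $P$ such that $\ell|_G$ attains its maximum ($-$) resp. minimum ($+$) at $v$; $F^\pm(v)$ its closure; $O^-$ is a stratification if $O^-(u)\cap F^-(v)\neq\emptyset$ implies $O^-(u)\subset F^-(v)$. Under these hypotheses the relation "$v\preceq w$ iff some face $G$ of $P$ has $\ell|_G$ minimal at $v$ and maximal at $w$" is a partial order on vertices (the vertex poset), graded by $\rho(v)=\dim F^-(v)$. For $v\preceq w$ let $\mathcal{S}_{vw}$ be the set of faces of $P$ with minimal vertex $v$ and maximal vertex $w$ (w.r.t. $\ell$), and $\kappa_{vw}(x)=\sum_{F\in\mathcal{S}_{vw}}(x-1)^{\dim F}$ (so $\kappa_{vv}=1$). The incidence algebra consists of families $a=(a_{vw})_{v\preceq w}$ in $\mathbb{Z}[x]$ with product $(ab)_{vw}=\sum_{v\preceq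 u\preceq w}a_{vu}b_{uw}$ and unit $\delta$ ($\delta_{vv}=1$, $\delta_{vw}=0$ for $v\prec w$). The reduced kernel is $\overline\kappa_{vw}=\kappa_{vw}/(x-1)$ for $v\prec w$ and $\overline\kappa_{vv}=-1$; the Chow polynomial is $\mathrm{H}=-(\overline\kappa)^{-1}$. Monotone path polytope: with $[a,b]=\ell(Q)$, $a<b$, $\mathrm{CH}_\ell(Q)=\{\frac{1}{b-a}\int_a^b\gamma(t)\,dt : \gamma:[a,b]\to Q \text{ continuous}, \ell(\gamma(t))=t\}$; if $Q$ is a point, $\mathrm{CH}_\ell(Q)$ is a point. The $h$-polynomial of a $d$-dimensional polytope $R$ is $\sum_{i=0}^d f_{i-1}(R)(x-1)^{d-i}$ with $f_{-1}=1$. *)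

theory Defs
  imports "HOL-Analysis.Analysis" "HOL-Computational_Algebra.Polynomial"
begin

subsection \<open>Strata, vertex poset and kernel\<close>

definition Ominus :: "'a::euclidean_space set \<Rightarrow> ('a \<Rightarrow> real) \<Rightarrow> 'a \<Rightarrow> 'a set" where
  "Ominus P l v = \<Union>{rel_interior G | G. G face_of P \<and> v \<in> G \<and> (\<forall>x\<in>G. l x \<le> l v)}"

definition Oplus :: "'a::euclidean_space set \<Rightarrow> ('a \<Rightarrow> real) \<Rightarrow> 'a \<Rightarrow> 'a set" where
  "Oplus P l v = \<Union>{rel_interior G | G. G face_of P \<and> v \<in> G \<and> (\<forall>x\<in>G. l v \<le> l x)}"

definition Fminus :: "'a::euclidean_space set \<Rightarrow> ('a \<Rightarrow> real) \<Rightarrow> 'a \<Rightarrow> 'a set" where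
  "Fminus P l v = closure (Ominus P l v)"

definition Fplus :: "'a::euclidean_space set \<Rightarrow> ('a \<Rightarrow> real) \<Rightarrow> 'a \<Rightarrow> 'a set" where
  "Fplus P l v = closure (Oplus P l v)"

definition Ominus_stratification :: "'a::euclidean_space set \<Rightarrow> ('a \<Rightarrow> real) \<Rightarrow> bool" where
  "Ominus_stratification P l \<longleftrightarrow>
     (\<forall>u v. u extreme_point_of P \<longrightarrow> v extreme_point_of P \<longrightarrow>
        Ominus P l u \<inter> Fminus P l v \<noteq> {} \<longrightarrow> Ominus P l u \<subseteq> Fminus P l v)"

definition faces_between :: "'a::euclidean_space set \<Rightarrow> ('a \<Rightarrow> real) \<Rightarrow> 'a \<Rightarrow> 'a \<Rightarrow> 'a set set" where
  "faces_between P l v w =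
     {F. F face_of P \<and> v \<in> F \<and> w \<in> F \<and> (\<forall>x\<in>F. l v \<le> l x \<and> l x \<le> l w)}"

definition vertex_le :: "'a::euclidean_space set \<Rightarrow> ('a \<Rightarrow> real) \<Rightarrow> 'a \<Rightarrow> 'a \<Rightarrow> bool" where
  "vertex_le P l v w \<longleftrightarrow>
     v extreme_point_of P \<and> w extreme_point_of P \<and> faces_between P l v w \<noteq> {}"

definition kappa :: "'a::euclidean_space set \<Rightarrow> ('a \<Rightarrow> real) \<Rightarrow> 'a \<Rightarrow> 'a \<Rightarrow> int poly" where
  "kappa P l v w = (\<Sum>F\<in>faces_between P l v w. [:-1, 1:] ^ nat (aff_dim F))"

subsection \<open>Incidence algebra\<close>

text \<open>A family indexed by the pairs \<open>v \<preceq> w\<close> is encoded as a function of two arguments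
  that vanishes whenever \<open>v \<preceq> w\<close> fails. This makes equality of families equality of functions,
  so that the two-sided inverse below is unique when it exists.\<close>

definition inc_family :: "('a \<Rightarrow> 'a \<Rightarrow> bool) \<Rightarrow> ('a \<Rightarrow> 'a \<Rightarrow> int poly) \<Rightarrow> bool" where
  "inc_family le a \<longleftrightarrow> (\<forall>v w. \<not> le v w \<longrightarrow> a v w = 0)"

definition inc_mult ::
  "('a \<Rightarrow> 'a \<Rightarrow> bool) \<Rightarrow> ('a \<Rightarrow> 'a \<Rightarrow> int poly) \<Rightarrow> ('a \<Rightarrow> 'a \<Rightarrow> int poly) \<Rightarrow> 'a \<Rightarrow> 'a \<Rightarrow> int poly" where
  "inc_mult le a b v w =
     (if le v w then (\<Sum>u\<in>{u. le v u \<and> le u w}. a v u * b u w) else 0)"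

definition inc_unit :: "('a \<Rightarrow> 'a \<Rightarrow> bool) \<Rightarrow> 'a \<Rightarrow> 'a \<Rightarrow> int poly" where
  "inc_unit le v w = (if le v w \<and> v = w then 1 else 0)"

definition inc_inverse ::
  "('a \<Rightarrow> 'a \<Rightarrow> bool) \<Rightarrow> ('a \<Rightarrow> 'a \<Rightarrow> int poly) \<Rightarrow> 'a \<Rightarrow> 'a \<Rightarrow> int poly" where
  "inc_inverse le a =
     (THE b. inc_family le b \<and> inc_mult le a b = inc_unit le \<and> inc_mult le b a = inc_unit le)"

text \<open>The polynomial division below is exact: a face containing two distinct vertices has
  dimension at least one.\<close>

definition reduced_kappa :: "'a::euclidean_space set \<Rightarrow> ('a \<Rightarrow> real) \<Rightarrow> 'a \<Rightarrow> 'a \<Rightarrow> int poly" where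
  "reduced_kappa P l v w =
     (if \<not> vertex_le P l v w then 0 else if v = w then -1 else kappa P l v w div [:-1, 1:])"

definition chow_poly :: "'a::euclidean_space set \<Rightarrow> ('a \<Rightarrow> real) \<Rightarrow> 'a \<Rightarrow> 'a \<Rightarrow> int poly" where
  "chow_poly P l v w = - inc_inverse (vertex_le P l) (reduced_kappa P l) v w"

subsection \<open>Monotone path polytope, \<open>h\<close>-polynomial and duality\<close>

definition monotone_path_polytope :: "('a::euclidean_space \<Rightarrow> real) \<Rightarrow> 'a set \<Rightarrow> 'a set" where
  "monotone_path_polytope l Q =
     (if \<exists>p. Q = {p} then Q
      else {(1 / (b - a)) *\<^sub>R integral {a..b} \<gamma> | a b \<gamma>.
              a < b \<and> l ` Q = {a..b} \<and> continuous_on {a..b} \<gamma> \<and>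
              (\<forall>t\<in>{a..b}. \<gamma> t \<in> Q \<and> l (\<gamma> t) = t)})"

definition num_faces :: "'a::euclidean_space set \<Rightarrow> int \<Rightarrow> nat" where
  "num_faces R k = card {F. F face_of R \<and> aff_dim F = k}"

text \<open>The empty set is a face of dimension \<open>-1\<close>, so \<open>num_faces R (-1) = 1\<close> for convex \<open>R\<close>.\<close>

definition h_poly :: "'a::euclidean_space set \<Rightarrow> int poly" where
  "h_poly R = (let d = nat (aff_dim R) in
     \<Sum>i=0..d. of_nat (num_faces R (int i - 1)) * [:-1, 1:] ^ (d - i))"

text \<open>The dual polytope is only determined up to combinatorial equivalence: \<open>R\<close> is dual to \<open>Q\<close>
  if there is an inclusion-reversing bijection between their face lattices (which include the
  empty face and the whole polytope).\<close>

definition dual_polytope_of :: "'b::euclidean_space set \<Rightarrow> 'a::euclidean_space set \<Rightarrow> bool" where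
  "dual_polytope_of R Q \<longleftrightarrow> polytope R \<and>
     (\<exists>\<phi>. bij_betw \<phi> {F. F face_of Q} {G. G face_of R} \<and>
          (\<forall>F G. F face_of Q \<longrightarrow> G face_of Q \<longrightarrow> (F \<subseteq> G \<longleftrightarrow> \<phi> G \<subseteq> \<phi> F)))"

end

theory Submission
  imports Defs
begin

text \<open>The inverse of the reduced kernel expands as a sum over cellular strings, i.e. chains of faces
  \<open>F1, ..., Fk\<close> of \<open>P\<close> leading upwards from \<open>v\<close> to \<open>w\<close>, where a string has weight \<open>(x - 1)\<close> to
  the power \<open>\<Sum>(dim Fi - 1)\<close>. Faces of a monotone path polytope correspond to the coherent cellular
  strings, those cut out by the lower boundary of a planar projection \<open>(l, g)\<close>. Writing
  \<open>Q v w = Fplus v \<inter> Fminus w\<close>, the stratification hypothesis makes \<open>dim Q\<close> additive along the vertex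
  poset, so at an intermediate vertex \<open>u\<close> the direction spaces of \<open>Q v u\<close> and \<open>Q u w\<close> are
  independent. Hence the functional \<open>g\<close> can be chosen one cell at a time: every string is
  coherent, and its face has dimension exactly \<open>\<Sum>(dim Fi - 1)\<close>.\<close>

subsection \<open>Linear functionals on polytopes\<close>

text \<open>For an arbitrary polytope the monotone path polytope sees coherent strings only, whereas
  inverting the reduced kernel counts all strings; the identity rests on there being no difference
  here. The additivity behind this is local. Along an edge of \<open>Q v w\<close> at
  \<open>u\<close> the functional \<open>l\<close> falls or rises, so the edge lies in
  \<open>Q v u\<close> or in \<open>Q u w\<close>. The optimality criterion of linear programming
  looks only at edges at \<open>u\<close>; hence a functional constant on both parts is constant on
  \<open>Q v w\<close>, and its dimension is at most the sum. Equality follows by climbing covers: a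
  cover step raises the dimension, and its own face is a segment, so the bound leaves room for
  exactly one. Compatibility is assumed for the strata \<open>Ominus\<close> only. The descriptions
  of the order by \<open>Fminus\<close> and by \<open>Fplus\<close> must be proved equivalent before
  both parts can be treated alike. Sections inside a cell differ at each level by directions on
  which \<open>l\<close> vanishes. This costs one dimension per cell, matching the division by
  \<open>x - 1\<close> in the reduced kernel.\<close>

lemma linear_functional_inner:
  fixes f :: "'a::euclidean_space \<Rightarrow> real"
  assumes "linear f"
  obtains a where "f = (\<lambda>x. a \<bullet> x)"
proof
  show "f = (\<lambda>x. adjoint f 1 \<bullet> x)"
    using adjoint_works[OF assms] by (auto simp: inner_commute)
qed

lemma linear_minimum_face:
  fixes h :: "'a::euclidean_space \<Rightarrow> real"
  assumes "linear h" "convex S" "\<And>x. x \<in> S \<Longrightarrow> m \<le> h x"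
  shows "{x\<in>S. h x = m} face_of S"
proof -
  obtain a where a: "h = (\<lambda>x. a \<bullet> x)" using linear_functional_inner[OF assms(1)] .
  have "S \<inter> {x. a \<bullet> x = m} face_of S"
    using assms a by (intro face_of_Int_supporting_hyperplane_ge) auto
  moreover have "S \<inter> {x. a \<bullet> x = m} = {x\<in>S. h x = m}" using a by auto
  ultimately show ?thesis by simp
qed

lemma exposing_functional:
  fixes S :: "'a::euclidean_space set"
  assumes "polytope S" "F face_of S" "F \<noteq> {}"
  obtains h :: "'a \<Rightarrow> real" and m where "linear h" "\<And>x. x \<in> S \<Longrightarrow> m \<le> h x" "\<And>x. x \<in> S \<Longrightarrow> h x = m \<longleftrightarrow> x \<in> F"
proof -
  have "F exposed_face_of S"
    using assms exposed_face_of_polyhedron polytope_imp_polyhedron by blast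
  then obtain a b where ab: "S \<subseteq> {x. a \<bullet> x \<le> b}" "F = S \<inter> {x. a \<bullet> x = b}"
    unfolding exposed_face_of_def by blast
  show ?thesis
  proof (rule that)
    show "linear (\<lambda>x. (- a) \<bullet> x)"
      by (intro bounded_linear.linear bounded_linear_inner_right)
    show "- b \<le> (- a) \<bullet> x" if "x \<in> S" for x using ab that by auto
    show "((- a) \<bullet> x = - b) = (x \<in> F)" if "x \<in> S" for x using ab that by auto
  qed
qed

lemma polytope_subset_of_vertices:
  fixes G :: "'a::euclidean_space set"
  assumes "polytope G" "convex K" "\<And>x. x extreme_point_of G \<Longrightarrow> x \<in> K"
  shows "G \<subseteq> K"
proof -
  have "G = convex hull {x. x extreme_point_of G}"
    using assms(1) by (intro Krein_Milman_Minkowski polytope_imp_compact polytope_imp_convex)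
  also have "\<dots> \<subseteq> K" using assms(2,3) by (intro hull_minimal) auto
  finally show ?thesis .
qed

lemma linear_ge_of_vertices:
  fixes h :: "'a::euclidean_space \<Rightarrow> real"
  assumes "polytope G" "linear h" "\<And>x. x extreme_point_of G \<Longrightarrow> m \<le> h x" "x \<in> G"
  shows "m \<le> h x"
proof -
  obtain a where a: "h = (\<lambda>x. a \<bullet> x)" using linear_functional_inner[OF assms(2)] .
  have "G \<subseteq> {x. a \<bullet> x \<ge> m}"
    using assms(1,3) a by (intro polytope_subset_of_vertices convex_halfspace_ge) auto
  then show ?thesis using assms(4) a by auto
qed

lemma finite_vertices:
  fixes G :: "'a::euclidean_space set"
  assumes "polytope G"
  shows "finite {x. x extreme_point_of G}"
proof -
  have "(\<lambda>x. {x}) ` {x. x extreme_point_of G} \<subseteq> {F. F face_of G}"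
    by (auto simp: face_of_singleton)
  then have "finite ((\<lambda>x. {x}) ` {x. x extreme_point_of G})"
    using finite_polytope_faces[OF assms] finite_subset by blast
  then show ?thesis by (rule finite_imageD) (auto simp: inj_on_def)
qed

lemma polytope_vertex_exists:
  fixes G :: "'a::euclidean_space set"
  assumes "polytope G" "G \<noteq> {}"
  obtains x where "x extreme_point_of G"
  using extreme_point_exists_convex assms polytope_imp_compact polytope_imp_convex by blast

text \<open>A facet through \<open>u\<close> has one dimension less, so descending through facets
  ends at an edge.\<close>

lemma polytope_edge_at_vertex:
  fixes G :: "'a::euclidean_space set"
  assumes "polytope G" "u extreme_point_of G" "G \<noteq> {u}"
  obtains E where "E edge_of G" "u \<in> E"
proof -
  have "\<exists>E. E edge_of G \<and> u \<in> E"
    using assms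
  proof (induction "nat (aff_dim G)" arbitrary: G rule: less_induct)
    case less
    have u: "u \<in> G" using less.prems(2) extreme_point_of_def by blast
    have "convex G" using less.prems(1) polytope_imp_convex by blast
    have "aff_dim {u} < aff_dim G"
      using less.prems \<open>convex G\<close> by (intro face_of_aff_dim_lt) (auto simp: face_of_singleton)
    then have d: "aff_dim G \<ge> 1" by simp
    show ?case
    proof (cases "aff_dim G = 1")
      case True
      then have "G edge_of G" using \<open>convex G\<close> by (simp add: edge_of_def face_of_refl)
      then show ?thesis using u by blast
    next
      case False
      obtain F where F: "F facet_of G" "{u} \<subseteq> F"
        using face_of_polyhedron_subset_facet[of G "{u}"] less.prems polytope_imp_polyhedron
        by (metis face_of_singleton insert_not_empty)
      have FG: "F face_of G" using F facet_of_imp_face_of by blast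
      have dF: "aff_dim F = aff_dim G - 1" using F by (simp add: facet_of_def)
      have "\<exists>E. E edge_of F \<and> u \<in> E"
      proof (rule less.hyps)
        show "nat (aff_dim F) < nat (aff_dim G)" using dF d by linarith
        show "polytope F" using FG less.prems(1) face_of_polytope_polytope by blast
        show "u extreme_point_of F" using FG F less.prems(2) extreme_point_of_face by blast
        show "F \<noteq> {u}" using dF d False by auto
      qed
      then show ?thesis using FG unfolding edge_of_def by (meson face_of_trans)
    qed
  qed
  then show thesis using that by blast
qed

lemma edge_at_vertex_segment:
  fixes P :: "'a::euclidean_space set"
  assumes "polytope P" "E edge_of P" "u extreme_point_of P" "u \<in> E"
  obtains e where "e \<noteq> u" "e extreme_point_of P" "E = closed_segment u e"
proof -
  have E: "E face_of P" "aff_dim E = 1" using assms(2) by (auto simp: edge_of_def)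
  have pE: "polytope E" using E assms(1) face_of_polytope_polytope by blast
  obtain a b where ab: "E = closed_segment a b"
    using compact_convex_collinear_segment[of E] pE assms(4) E(2)
    by (metis collinear_aff_dim empty_iff order_refl polytope_imp_compact polytope_imp_convex)
  have "u extreme_point_of E" using E assms extreme_point_of_face by blast
  then have u: "u = a \<or> u = b" using ab extreme_point_of_segment by blast
  have "a \<noteq> b" using E(2) ab by auto
  have ext: "a extreme_point_of P" "b extreme_point_of P"
    using segment_face_of E(1) ab by blast+
  show thesis
  proof (cases "u = a")
    case True
    then show ?thesis using that[of b] \<open>a \<noteq> b\<close> ext ab by auto
  next
    case False
    then have "u = b" using u by blast
    then show ?thesis using that[of a] \<open>a \<noteq> b\<close> ext ab by (auto simp: closed_segment_commute)
  qed
qed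

text \<open>Optimality criterion of the simplex method. If \<open>h\<close> took a value below \<open>h u\<close>, a functional
  \<open>f\<close> exposing \<open>u\<close> and the minimal slope \<open>M\<close> of \<open>h\<close> against \<open>f\<close> would cut out a face
  through \<open>u\<close> all of whose edges at \<open>u\<close> decrease \<open>h\<close>.\<close>

lemma vertex_minimal_of_edges:
  fixes h :: "'a::euclidean_space \<Rightarrow> real"
  assumes P: "polytope P" and u: "u extreme_point_of P" and h: "linear h"
    and edges: "\<And>E x. E edge_of P \<Longrightarrow> u \<in> E \<Longrightarrow> x \<in> E \<Longrightarrow> h u \<le> h x"
    and x: "x \<in> P"
  shows "h u \<le> h x"
proof (rule ccontr)
  assume "\<not> h u \<le> h x"
  have "convex P" using P polytope_imp_convex by blast
  let ?V = "{y. y extreme_point_of P} - {u}"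
  obtain y where y: "y extreme_point_of P" "h y < h u"
    using linear_ge_of_vertices[OF P h _ x, of "h u"] \<open>\<not> h u \<le> h x\<close> by force
  obtain f :: "'a \<Rightarrow> real" and m where f: "linear f" "\<And>x. x \<in> P \<Longrightarrow> m \<le> f x" "\<And>x. x \<in> P \<Longrightarrow> f x = m \<longleftrightarrow> x \<in> {u}"
    using exposing_functional[OF P, of "{u}"] u by (auto simp: face_of_singleton)
  have uP: "u \<in> P" using u extreme_point_of_def by blast
  have fpos: "f y > f u" if "y \<in> P" "y \<noteq> u" for y
    using f(2)[OF that(1)] f(3)[OF that(1)] f(3)[OF uP] that(2) by force
  define M where "M = Min ((\<lambda>y. (h y - h u) / (f y - f u)) ` ?V)"
  have fin: "finite ?V" using finite_vertices[OF P] by simp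
  have ne: "?V \<noteq> {}" using y by auto
  have Vp: "z \<in> P" if "z \<in> ?V" for z using that extreme_point_of_def by auto
  obtain z where z: "z \<in> ?V" "M = (h z - h u) / (f z - f u)"
    using Min_in[of "(\<lambda>y. (h y - h u) / (f y - f u)) ` ?V"] fin ne unfolding M_def by blast
  have zf: "f z > f u" using fpos z(1) Vp by auto
  have "M \<le> (h y - h u) / (f y - f u)"
    unfolding M_def using fin y by (intro Min_le) auto
  moreover have "(h y - h u) / (f y - f u) < 0"
    using y fpos[of y] extreme_point_of_def[of y P] by (intro divide_neg_pos) auto
  ultimately have "M < 0" by linarith
  let ?k = "\<lambda>x. h x - M * f x"
  have k: "linear ?k"
    using linear_compose_sub[OF h linear_compose_scale_right[OF f(1), of M]] by simp
  have kge: "?k u \<le> ?k x" if "x \<in> P" for x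
  proof (rule linear_ge_of_vertices[OF P k _ that])
    fix e assume e: "e extreme_point_of P"
    show "?k u \<le> ?k e"
    proof (cases "e = u")
      case False
      then have "M \<le> (h e - h u) / (f e - f u)"
        unfolding M_def using fin e by (intro Min_le) auto
      moreover have "f e > f u" using fpos e False extreme_point_of_def by blast
      ultimately have "M * (f e - f u) \<le> h e - h u" by (simp add: pos_le_divide_eq)
      then show ?thesis by (simp add: algebra_simps)
    qed simp
  qed
  define G where "G = {x\<in>P. ?k x = ?k u}"
  have G: "G face_of P" unfolding G_def using k \<open>convex P\<close> kge by (intro linear_minimum_face)
  have uG: "u \<in> G" using uP by (simp add: G_def)
  have "?k z = ?k u" using z(2) zf by (simp add: field_simps)
  then have "z \<in> G" using z Vp by (simp add: G_def)
  then have "G \<noteq> {u}" using z by auto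
  moreover have "polytope G" using G P face_of_polytope_polytope by blast
  moreover have "u extreme_point_of G" using G uG u extreme_point_of_face by blast
  ultimately obtain E where E: "E edge_of G" "u \<in> E" using polytope_edge_at_vertex by blast
  have EP: "E edge_of P" using E G unfolding edge_of_def by (meson face_of_trans)
  obtain e where e: "e \<noteq> u" "e extreme_point_of P" "E = closed_segment u e"
    using edge_at_vertex_segment[OF P EP u E(2)] .
  have "e \<in> E" using e by simp
  then have "e \<in> G" using E edge_of_imp_subset by blast
  then have "?k e = ?k u" "e \<in> P" by (auto simp: G_def)
  then have "h e - h u = M * (f e - f u)" by (simp add: algebra_simps)
  moreover have "f e > f u" using fpos e \<open>e \<in> P\<close> by blast
  ultimately have "h e < h u" using \<open>M < 0\<close> by (smt (verit) mult_neg_pos)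
  then show False using edges[OF EP E(2) \<open>e \<in> E\<close>] by simp
qed

text \<open>A functional exposing \<open>F\<close> is constant along all edges at \<open>u\<close>.
  The optimality criterion, applied to its negative, makes its minimum over \<open>Z\<close> a
  maximum as well, so it is constant on \<open>Z\<close>.\<close>

lemma face_eq_of_edges:
  fixes Z :: "'a::euclidean_space set"
  assumes Z: "polytope Z" and F: "F face_of Z" and u: "u extreme_point_of Z" "u \<in> F"
    and edges: "\<And>E. E edge_of Z \<Longrightarrow> u \<in> E \<Longrightarrow> E \<subseteq> F"
  shows "F = Z"
proof
  show "F \<subseteq> Z" using F face_of_imp_subset by blast
  have "F \<noteq> {}" using u by blast
  then obtain h :: "'a \<Rightarrow> real" and m where h: "linear h" "\<And>x. x \<in> Z \<Longrightarrow> m \<le> h x" "\<And>x. x \<in> Z \<Longrightarrow> h x = m \<longleftrightarrow> x \<in> F"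
    using exposing_functional[OF Z F] by blast
  have hF: "h x = m" if "x \<in> F" for x using h(3) that \<open>F \<subseteq> Z\<close> by blast
  have nh: "linear (\<lambda>x. - h x)" using h(1) by (rule linear_compose_neg)
  show "Z \<subseteq> F"
  proof
    fix x assume x: "x \<in> Z"
    have "- h u \<le> - h y" if "E edge_of Z" "u \<in> E" "y \<in> E" for E y
      using edges[OF that(1,2)] hF[of y] hF[of u] u(2) that(3) by auto
    then have "- h u \<le> - h x"
      by (rule vertex_minimal_of_edges[OF Z u(1) nh _ x])
    then have "h x = m" using h(2)[OF x] hF[OF u(2)] by linarith
    then show "x \<in> F" using h(3) x by blast
  qed
qed

text \<open>Glues functionals given on two independent direction spaces. The union of two bases
  spans the sum and has as many elements as the dimension of that sum, so it is independent.\<close>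

lemma linear_extension_two:
  fixes S T :: "'a::euclidean_space set" and f g :: "'a \<Rightarrow> real"
  assumes S: "subspace S" and T: "subspace T" and ST: "S \<inter> T = {0}"
    and f: "linear f" and g: "linear g"
  obtains k where "linear k" "\<And>x. x \<in> S \<Longrightarrow> k x = f x" "\<And>x. x \<in> T \<Longrightarrow> k x = g x"
proof -
  obtain B where B: "B \<subseteq> S" "independent B" "span B = S"
    using basis_exists[of S] S by (metis span_subspace)
  obtain B' where B': "B' \<subseteq> T" "independent B'" "span B' = T"
    using basis_exists[of T] T by (metis span_subspace)
  have disj: "B \<inter> B' = {}"
  proof -
    have "0 \<notin> B" using B(2) dependent_zero by blast
    moreover have "B \<inter> B' \<subseteq> {0}" using B(1) B'(1) ST by blast
    ultimately show ?thesis by blast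
  qed
  have ind: "independent (B \<union> B')"
  proof (rule card_le_dim_spanning)
    let ?V = "{x + y |x y. x \<in> S \<and> y \<in> T}"
    show "?V \<subseteq> span (B \<union> B')" using B B' by (auto simp: span_Un)
    show "B \<union> B' \<subseteq> ?V"
    proof
      fix b assume "b \<in> B \<union> B'"
      then have "b \<in> S \<or> b \<in> T" using B(1) B'(1) by blast
      then show "b \<in> ?V"
      proof
        assume "b \<in> S"
        then have "b = b + 0 \<and> b \<in> S \<and> 0 \<in> T" using T by (simp add: subspace_0)
        then show ?thesis by blast
      next
        assume "b \<in> T"
        then have "b = 0 + b \<and> 0 \<in> S \<and> b \<in> T" using S by (simp add: subspace_0)
        then show ?thesis by blast
      qed
    qed
    show "finite (B \<union> B')" using B B' by (simp add: finiteI_independent)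
    have "dim ?V = dim S + dim T" using dim_sums_Int[OF S T] ST by simp
    also have "\<dots> = card B + card B'"
      using dim_span_eq_card_independent[OF B(2)] dim_span_eq_card_independent[OF B'(2)] B(3) B'(3) by simp
    also have "\<dots> = card (B \<union> B')"
      using disj B(2) B'(2) by (simp add: card_Un_disjoint finiteI_independent)
    finally show "card (B \<union> B') \<le> dim ?V" by simp
  qed
  obtain k where k: "linear k" "\<forall>x\<in>B \<union> B'. k x = (if x \<in> B then f x else g x)"
    using linear_independent_extend[OF ind, of "\<lambda>x. if x \<in> B then f x else g x"] by blast
  show thesis
  proof (rule that[OF k(1)])
    fix x assume "x \<in> S"
    then show "k x = f x" using linear_eq_on_span[OF k(1) f, of B] k(2) B by auto
  next
    fix x assume "x \<in> T"
    moreover have "k b = g b" if "b \<in> B'" for b using k(2) that disj by auto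
    ultimately show "k x = g x" using linear_eq_on_span[OF k(1) g, of B'] B' by auto
  qed
qed

subsection \<open>Direction spaces\<close>

text \<open>The linear space parallel to the affine hull of a nonempty \<open>S\<close>. Taking all
  differences avoids a base point, so that direction spaces of different faces can be compared
  directly.\<close>

definition dirs :: "'a::euclidean_space set \<Rightarrow> 'a set" where
  "dirs S = span {x - y | x y. x \<in> S \<and> y \<in> S}"

lemma subspace_dirs [simp]: "subspace (dirs S)"
  by (simp add: dirs_def)

lemma diff_in_dirs: "x \<in> S \<Longrightarrow> y \<in> S \<Longrightarrow> x - y \<in> dirs S"
  unfolding dirs_def by (rule span_base) blast

lemma dirs_mono: "S \<subseteq> T \<Longrightarrow> dirs S \<subseteq> dirs T"
  unfolding dirs_def by (rule span_mono) blast

lemma dirs_eq_span: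
  assumes "a \<in> S"
  shows "dirs S = span ((\<lambda>x. x - a) ` S)"
proof
  show "span ((\<lambda>x. x - a) ` S) \<subseteq> dirs S"
    unfolding dirs_def using assms by (intro span_mono) blast
  have "x - y \<in> span ((\<lambda>x. x - a) ` S)" if "x \<in> S" "y \<in> S" for x y
  proof -
    have "x - y = (x - a) - (y - a)" by simp
    then show ?thesis using that by (metis image_eqI span_base span_diff)
  qed
  then show "dirs S \<subseteq> span ((\<lambda>x. x - a) ` S)"
    unfolding dirs_def by (intro span_minimal) auto
qed

lemma aff_dim_dirs:
  assumes "S \<noteq> {}"
  shows "aff_dim S = int (dim (dirs S))"
proof -
  obtain a where a: "a \<in> S" using assms by blast
  then show ?thesis
    by (metis aff_dim_eq_dim_subtract dim_span dirs_eq_span hull_inc)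
qed

text \<open>Turns membership in a subspace into a question about functionals. The part of
  \<open>x\<close> orthogonal to \<open>W\<close> provides the one required.\<close>

lemma not_in_subspace_functional:
  fixes W :: "'a::euclidean_space set"
  assumes W: "subspace W" and x: "x \<notin> W"
  obtains h :: "'a \<Rightarrow> real" where "linear h" "\<And>y. y \<in> W \<Longrightarrow> h y = 0" "h x \<noteq> 0"
proof -
  obtain a where a: "a \<noteq> 0" "a \<bullet> x \<noteq> 0" "\<And>y. y \<in> W \<Longrightarrow> a \<bullet> y = 0"
  proof -
    obtain y z where yz: "y \<in> span W" "\<And>w. w \<in> span W \<Longrightarrow> orthogonal z w" "x = y + z"
      using orthogonal_subspace_decomp_exists by metis
    have "z \<noteq> 0" using yz x W by (metis add.right_neutral span_eq_iff)
    have "z \<bullet> x = z \<bullet> z" using yz by (simp add: inner_add_right orthogonal_def)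
    then show thesis using that[of z] \<open>z \<noteq> 0\<close> yz(2) by (metis inner_eq_zero_iff orthogonal_def span_base)
  qed
  show thesis
    by (rule that[of "\<lambda>y. a \<bullet> y"])
      (use a in \<open>auto simp: bounded_linear.linear bounded_linear_inner_right\<close>)
qed

subsection \<open>The vertex poset\<close>

lemma constant_on_uminus: "(\<lambda>x. - l x :: real) constant_on E \<longleftrightarrow> l constant_on E"
  unfolding constant_on_def by (metis minus_minus)

text \<open>The minimisers of \<open>l\<close> on \<open>F\<close> form a face of \<open>P\<close>.
  If it were larger than a vertex, it would contain an edge of \<open>P\<close> on which
  \<open>l\<close> is constant.\<close>

lemma unique_minimum:
  fixes l :: "'a::euclidean_space \<Rightarrow> real"
  assumes P: "polytope P" and l: "linear l" and edges: "\<And>E. E edge_of P \<Longrightarrow> \<not> l constant_on E"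
    and F: "F face_of P" "x \<in> F" "y \<in> F" "\<And>z. z \<in> F \<Longrightarrow> l x \<le> l z" "l y = l x"
  shows "y = x"
proof -
  have cF: "convex F" using F(1) face_of_imp_convex by blast
  define M where "M = {z\<in>F. l z = l x}"
  have "M face_of F" unfolding M_def using l cF F(4) by (intro linear_minimum_face)
  then have MP: "M face_of P" using F(1) face_of_trans by blast
  have xM: "x \<in> M" "y \<in> M" using F by (auto simp: M_def)
  have pM: "polytope M" using MP P face_of_polytope_polytope by blast
  obtain u where u: "u extreme_point_of M" using polytope_vertex_exists[OF pM] xM by blast
  have "M = {u}"
  proof (rule ccontr)
    assume "M \<noteq> {u}"
    then obtain E where E: "E edge_of M" using polytope_edge_at_vertex[OF pM u] by blast
    then have "E edge_of P" using MP unfolding edge_of_def by (meson face_of_trans)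
    moreover have "l constant_on E"
      using E edge_of_imp_subset[OF E] unfolding constant_on_def M_def by blast
    ultimately show False using edges by blast
  qed
  then show ?thesis using xM by blast
qed

lemma unique_maximum:
  fixes l :: "'a::euclidean_space \<Rightarrow> real"
  assumes P: "polytope P" and l: "linear l" and edges: "\<And>E. E edge_of P \<Longrightarrow> \<not> l constant_on E"
    and F: "F face_of P" "x \<in> F" "y \<in> F" "\<And>z. z \<in> F \<Longrightarrow> l z \<le> l x" "l y = l x"
  shows "y = x"
proof (rule unique_minimum[OF P _ _ F(1,2,3), where l = "\<lambda>x. - l x"])
  show "linear (\<lambda>x. - l x)" using l by (rule linear_compose_neg)
qed (use edges F in \<open>auto simp: constant_on_uminus\<close>)

lemma minimal_vertex_exists:
  fixes l :: "'a::euclidean_space \<Rightarrow> real"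
  assumes "polytope F" "linear l" "F \<noteq> {}"
  obtains u where "u extreme_point_of F" "\<And>x. x \<in> F \<Longrightarrow> l u \<le> l x"
proof -
  let ?V = "{x. x extreme_point_of F}"
  have fin: "finite ?V" using assms finite_vertices by blast
  have "?V \<noteq> {}" using polytope_vertex_exists[OF assms(1,3)] by blast
  then obtain u where u: "u \<in> ?V" "l u = Min (l ` ?V)"
    using Min_in[of "l ` ?V"] fin by (metis (no_types, lifting) finite_imageI imageE image_is_empty)
  have "l u \<le> l x" if "x \<in> F" for x
  proof (rule linear_ge_of_vertices[OF assms(1,2) _ that])
    show "l u \<le> l y" if "y extreme_point_of F" for y using u fin that by simp
  qed
  then show thesis using that u by blast
qed

lemma maximal_vertex_exists:
  fixes l :: "'a::euclidean_space \<Rightarrow> real"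
  assumes "polytope F" "linear l" "F \<noteq> {}"
  obtains u where "u extreme_point_of F" "\<And>x. x \<in> F \<Longrightarrow> l x \<le> l u"
proof -
  have "linear (\<lambda>x. - l x)" using assms(2) by (rule linear_compose_neg)
  then obtain u where "u extreme_point_of F" "\<And>x. x \<in> F \<Longrightarrow> - l u \<le> - l x"
    using minimal_vertex_exists assms by blast
  then show thesis using that by auto
qed

locale stratified_polytope =
  fixes P :: "'a::euclidean_space set" and l :: "'a \<Rightarrow> real"
  assumes polytope_P: "polytope P"
    and linear_l: "linear l"
    and edge_nonconstant: "\<And>E. E edge_of P \<Longrightarrow> \<not> l constant_on E"
    and Fminus_face: "\<And>u. u extreme_point_of P \<Longrightarrow> Fminus P l u face_of P"
    and Fplus_face: "\<And>u. u extreme_point_of P \<Longrightarrow> Fplus P l u face_of P"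
    and stratification: "Ominus_stratification P l"
begin

abbreviation "le \<equiv> vertex_le P l"

text \<open>For \<open>le v w\<close> this is the largest face with minimal vertex \<open>v\<close>
  and maximal vertex \<open>w\<close>, so each cell from \<open>v\<close> to \<open>w\<close> is one
  of its faces.\<close>

definition Q :: "'a \<Rightarrow> 'a \<Rightarrow> 'a set" where
  "Q v w = Fplus P l v \<inter> Fminus P l w"

section \<open>Closed strata and their extreme vertices\<close>

lemma continuous_on_l: "continuous_on S l"
  using linear_l linear_continuous_on linear_conv_bounded_linear by blast

lemma face_closure: "G face_of P \<Longrightarrow> closure (rel_interior G) = G"
  using polytope_P face_of_polytope_polytope polytope_imp_compact compact_imp_closed
    convex_closure_rel_interior face_of_imp_convex closure_closed by metis

lemma Fminus_le: "x \<in> Fminus P l u \<Longrightarrow> l x \<le> l u"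
proof -
  have "Ominus P l u \<subseteq> {x. l x \<le> l u}"
    unfolding Ominus_def using rel_interior_subset by fast
  moreover have "closed {x. l x \<le> l u}"
    by (intro closed_Collect_le continuous_on_l continuous_intros)
  ultimately have "Fminus P l u \<subseteq> {x. l x \<le> l u}"
    unfolding Fminus_def by (rule closure_minimal)
  then show "x \<in> Fminus P l u \<Longrightarrow> l x \<le> l u" by blast
qed

lemma Fplus_ge: "x \<in> Fplus P l u \<Longrightarrow> l u \<le> l x"
proof -
  have "Oplus P l u \<subseteq> {x. l u \<le> l x}"
    unfolding Oplus_def using rel_interior_subset by fast
  moreover have "closed {x. l u \<le> l x}"
    by (intro closed_Collect_le continuous_on_l continuous_intros)
  ultimately have "Fplus P l u \<subseteq> {x. l u \<le> l x}"
    unfolding Fplus_def by (rule closure_minimal)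
  then show "x \<in> Fplus P l u \<Longrightarrow> l u \<le> l x" by blast
qed

lemma subset_Fminus:
  assumes "G face_of P" "u \<in> G" "\<And>x. x \<in> G \<Longrightarrow> l x \<le> l u"
  shows "G \<subseteq> Fminus P l u"
proof -
  have "rel_interior G \<subseteq> Ominus P l u" unfolding Ominus_def using assms by blast
  then have "closure (rel_interior G) \<subseteq> Fminus P l u" unfolding Fminus_def by (rule closure_mono)
  then show ?thesis using face_closure assms(1) by simp
qed

lemma subset_Fplus:
  assumes "G face_of P" "u \<in> G" "\<And>x. x \<in> G \<Longrightarrow> l u \<le> l x"
  shows "G \<subseteq> Fplus P l u"
proof -
  have "rel_interior G \<subseteq> Oplus P l u" unfolding Oplus_def using assms by blast
  then have "closure (rel_interior G) \<subseteq> Fplus P l u" unfolding Fplus_def by (rule closure_mono)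
  then show ?thesis using face_closure assms(1) by simp
qed

lemma self_in_Fminus: "u extreme_point_of P \<Longrightarrow> u \<in> Fminus P l u"
  using subset_Fminus[of "{u}" u] by (auto simp: face_of_singleton)

lemma self_in_Fplus: "u extreme_point_of P \<Longrightarrow> u \<in> Fplus P l u"
  using subset_Fplus[of "{u}" u] by (auto simp: face_of_singleton)

lemma Fminus_max_unique:
  "u extreme_point_of P \<Longrightarrow> x \<in> Fminus P l u \<Longrightarrow> l x = l u \<Longrightarrow> x = u"
  by (rule unique_maximum[OF polytope_P linear_l edge_nonconstant Fminus_face])
    (auto simp: self_in_Fminus Fminus_le)

lemma Fplus_min_unique:
  "u extreme_point_of P \<Longrightarrow> x \<in> Fplus P l u \<Longrightarrow> l x = l u \<Longrightarrow> x = u"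
  by (rule unique_minimum[OF polytope_P linear_l edge_nonconstant Fplus_face])
    (auto simp: self_in_Fplus Fplus_ge)

text \<open>The stratification enters here: \<open>u\<close> belongs to its own stratum, through the
  face \<open>{u}\<close>, so the whole stratum follows it into \<open>Fminus P l v\<close>.\<close>

lemma Fminus_mono:
  assumes "u extreme_point_of P" "v extreme_point_of P" "u \<in> Fminus P l v"
  shows "Fminus P l u \<subseteq> Fminus P l v"
proof -
  have "u \<in> rel_interior {u}" by simp
  moreover have "{u} face_of P" using assms(1) by (simp add: face_of_singleton)
  ultimately have "u \<in> Ominus P l u" unfolding Ominus_def by blast
  then have "Ominus P l u \<subseteq> Fminus P l v"
    using stratification assms unfolding Ominus_stratification_def by blast
  then show ?thesis unfolding Fminus_def by (rule closure_minimal) simp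
qed

section \<open>Edges at a vertex and the two descriptions of the order\<close>

lemma edge_at_vertex:
  assumes "E edge_of P" "u extreme_point_of P" "u \<in> E"
  obtains e where "e extreme_point_of P" "E = closed_segment u e" "l e \<noteq> l u"
proof -
  obtain e where e: "e \<noteq> u" "e extreme_point_of P" "E = closed_segment u e"
    using edge_at_vertex_segment[OF polytope_P assms] .
  have "l e \<noteq> l u"
  proof
    assume eq: "l e = l u"
    have "l x = l u" if x: "x \<in> E" for x
    proof -
      obtain t where "x = (1 - t) *\<^sub>R u + t *\<^sub>R e" using x e(3) by (auto simp: in_segment)
      then have "l x = (1 - t) * l u + t * l u"
        using linear_l eq by (simp add: linear_add linear_scale)
      then show ?thesis by (simp add: algebra_simps)
    qed
    then have "l constant_on E" unfolding constant_on_def by blast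
    then show False using edge_nonconstant assms(1) by blast
  qed
  then show thesis using that e by blast
qed

lemma segment_bounds:
  assumes "x \<in> closed_segment u e" "l u \<le> l e"
  shows "l u \<le> l x" "l x \<le> l e"
proof -
  obtain t where t: "x = (1 - t) *\<^sub>R u + t *\<^sub>R e" "0 \<le> t" "t \<le> 1"
    using assms(1) by (auto simp: in_segment)
  have eq: "l x = (1 - t) * l u + t * l e"
    using t linear_l by (simp add: linear_add linear_scale)
  have "(1 - t) * l u + t * l u \<le> l x" using eq t assms(2) by (simp add: mult_left_mono)
  then show "l u \<le> l x" by (simp add: algebra_simps)
  have "l x \<le> (1 - t) * l e + t * l e" using eq t assms(2) by (simp add: mult_left_mono)
  then show "l x \<le> l e" by (simp add: algebra_simps)
qed

lemma edge_in_Fminus_or_Fplus: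
  assumes "E edge_of P" "u extreme_point_of P" "u \<in> E"
  shows "E \<subseteq> Fminus P l u \<or> E \<subseteq> Fplus P l u"
proof -
  obtain e where e: "E = closed_segment u e" "l e \<noteq> l u"
    using edge_at_vertex[OF assms] by blast
  have E: "E face_of P" using assms(1) by (simp add: edge_of_def)
  show ?thesis
  proof (cases "l u < l e")
    case True
    then have "E \<subseteq> Fplus P l u"
      using subset_Fplus[OF E assms(3)] segment_bounds[of _ u e] e by simp
    then show ?thesis ..
  next
    case False
    then have "E \<subseteq> Fminus P l u"
      using subset_Fminus[OF E assms(3)] segment_bounds[of _ e u] e by (simp add: closed_segment_commute)
    then show ?thesis ..
  qed
qed

lemma edge_of_face: "E edge_of Z \<Longrightarrow> Z face_of P \<Longrightarrow> E edge_of P"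
  unfolding edge_of_def by (meson face_of_trans)

text \<open>Let \<open>u'\<close> be the top vertex of the face \<open>?G\<close>. An edge of
  \<open>Fminus P l v\<close> at \<open>u\<close> goes down and lies in \<open>Fminus P l u\<close>,
  or goes up and lies in \<open>?G\<close>; both are contained in \<open>Fminus P l u'\<close>. This
  face therefore contains all edges at \<open>u\<close> and is all of \<open>Fminus P l v\<close>,
  which forces \<open>u' = v\<close>.\<close>

lemma mem_Fplus_of_mem_Fminus:
  assumes u: "u extreme_point_of P" and v: "v extreme_point_of P" and uv: "u \<in> Fminus P l v"
  shows "v \<in> Fplus P l u"
proof -
  let ?G = "Fplus P l u \<inter> Fminus P l v"
  have G: "?G face_of P" using u v by (intro face_of_Int Fplus_face Fminus_face)
  have uG: "u \<in> ?G" using uv u self_in_Fplus by blast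
  obtain u' where u': "u' extreme_point_of ?G" "\<And>x. x \<in> ?G \<Longrightarrow> l x \<le> l u'"
    using maximal_vertex_exists[of ?G l] G polytope_P linear_l face_of_polytope_polytope uG by blast
  have u'P: "u' extreme_point_of P" "u' \<in> ?G"
    using u' G extreme_point_of_face by blast+
  have GF: "?G \<subseteq> Fminus P l u'" using G u'(2) u'P(2) by (intro subset_Fminus)
  have sub: "Fminus P l u' \<subseteq> Fminus P l v" using Fminus_mono u'P v by blast
  have sub2: "Fminus P l u \<subseteq> Fminus P l u'" using Fminus_mono u'P u GF uG by blast
  have "Fminus P l u' = Fminus P l v"
  proof (rule face_eq_of_edges[where u = u])
    show "polytope (Fminus P l v)"
      using v Fminus_face polytope_P face_of_polytope_polytope by blast
    show "Fminus P l u' face_of Fminus P l v"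
      using sub v u'P Fminus_face face_of_face by blast
    show "u extreme_point_of Fminus P l v" using extreme_point_of_face Fminus_face u v uv by blast
    show "u \<in> Fminus P l u'" using uG GF by blast
    show "E \<subseteq> Fminus P l u'" if E: "E edge_of Fminus P l v" "u \<in> E" for E
    proof -
      have "E edge_of P" using E v Fminus_face edge_of_face by blast
      then have "E \<subseteq> Fminus P l u \<or> E \<subseteq> Fplus P l u"
        using edge_in_Fminus_or_Fplus E(2) u by blast
      moreover have "E \<subseteq> Fminus P l v" using E(1) edge_of_imp_subset by blast
      ultimately show ?thesis using sub2 GF by blast
    qed
  qed
  then have "v \<in> Fminus P l u'" using self_in_Fminus v by blast
  then have "l v \<le> l u'" using Fminus_le by blast
  moreover have "l u' \<le> l v" using Fminus_le u'P by blast
  ultimately have "u' = v" using Fminus_max_unique v u'P by force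
  then show ?thesis using u'P by blast
qed

text \<open>A descent by the simplex method: a vertex of \<open>Fplus P l u\<close> other than
  \<open>u\<close> does not minimise \<open>l\<close> there, so some edge inside that face leads
  down from it. By monotonicity the walk stays in \<open>Fminus P l v\<close>, and it can stop only
  at \<open>u\<close>.\<close>

lemma mem_Fminus_of_mem_Fplus:
  assumes u: "u extreme_point_of P" and v: "v extreme_point_of P" and vu: "v \<in> Fplus P l u"
  shows "u \<in> Fminus P l v"
  using v vu
proof (induction "card {x. x extreme_point_of P \<and> l x < l v}" arbitrary: v rule: less_induct)
  case less
  show ?case
  proof (cases "v = u")
    case True
    then show ?thesis using u self_in_Fminus by blast
  next
    case False
    let ?F = "Fplus P l u"
    have F: "?F face_of P" "polytope ?F" using u Fplus_face polytope_P face_of_polytope_polytope by blast+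
    have vF: "v extreme_point_of ?F" using F less.prems extreme_point_of_face by blast
    have "l u \<noteq> l v" using False Fplus_min_unique[of u v] u less.prems by force
    then have lt: "l u < l v" using Fplus_ge less.prems by force
    have "\<exists>E x. E edge_of ?F \<and> v \<in> E \<and> x \<in> E \<and> l x < l v"
    proof (rule ccontr)
      assume "\<not> ?thesis"
      then have "l v \<le> l u"
        using vertex_minimal_of_edges[OF F(2) vF linear_l _ self_in_Fplus[OF u]] by (meson linorder_not_less)
      then show False using lt by simp
    qed
    then obtain E x where E: "E edge_of ?F" "v \<in> E" "x \<in> E" "l x < l v" by blast
    have EP: "E edge_of P" using E F edge_of_face by blast
    obtain e where e: "e extreme_point_of P" "E = closed_segment v e" "l e \<noteq> l v"
      using edge_at_vertex[OF EP less.prems(1) E(2)] .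
    have "l e < l v" using segment_bounds[of x v e] E e by force
    have "e \<in> E" using e by simp
    then have eF: "e \<in> ?F" using E edge_of_imp_subset by blast
    have "{x. x extreme_point_of P \<and> l x < l e} \<subset> {x. x extreme_point_of P \<and> l x < l v}"
      using \<open>l e < l v\<close> e(1) by force
    then have "card {x. x extreme_point_of P \<and> l x < l e} < card {x. x extreme_point_of P \<and> l x < l v}"
      using finite_vertices[OF polytope_P] by (intro psubset_card_mono) auto
    then have "u \<in> Fminus P l e" using less.hyps e(1) eF by blast
    moreover have "E \<subseteq> Fminus P l v"
      using EP E(2) e(2) segment_bounds[of _ e v] \<open>l e < l v\<close>
      by (intro subset_Fminus) (auto simp: edge_of_def closed_segment_commute)
    then have "Fminus P l e \<subseteq> Fminus P l v" using Fminus_mono e(1) less.prems(1) \<open>e \<in> E\<close> by blast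
    ultimately show ?thesis by blast
  qed
qed

text \<open>Replacing the existence of a face by membership of a point makes transitivity a
  consequence of \<open>Fminus_mono\<close>. In the converse direction the intersection of the two
  closed strata is the connecting face.\<close>

lemma le_iff_Fminus: "le u v \<longleftrightarrow> u extreme_point_of P \<and> v extreme_point_of P \<and> u \<in> Fminus P l v"
proof
  assume "le u v"
  then obtain F where F: "u extreme_point_of P" "v extreme_point_of P" "F \<in> faces_between P l u v"
    unfolding vertex_le_def by blast
  then have "F \<subseteq> Fminus P l v" by (intro subset_Fminus) (auto simp: faces_between_def)
  then show "u extreme_point_of P \<and> v extreme_point_of P \<and> u \<in> Fminus P l v"
    using F by (auto simp: faces_between_def)
next
  assume *: "u extreme_point_of P \<and> v extreme_point_of P \<and> u \<in> Fminus P l v"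
  then have "Fplus P l u \<inter> Fminus P l v \<in> faces_between P l u v"
    using mem_Fplus_of_mem_Fminus self_in_Fminus self_in_Fplus Fplus_ge Fminus_le
    unfolding faces_between_def by (auto intro: face_of_Int Fplus_face Fminus_face)
  then show "le u v" unfolding vertex_le_def using * by blast
qed

lemma le_iff_Fplus: "le u v \<longleftrightarrow> u extreme_point_of P \<and> v extreme_point_of P \<and> v \<in> Fplus P l u"
  using le_iff_Fminus mem_Fplus_of_mem_Fminus mem_Fminus_of_mem_Fplus by blast

lemma le_vertex: "le u v \<Longrightarrow> u extreme_point_of P" "le u v \<Longrightarrow> v extreme_point_of P"
  by (auto simp: vertex_le_def)

lemma le_refl: "u extreme_point_of P \<Longrightarrow> le u u"
  using le_iff_Fminus self_in_Fminus by blast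

lemma le_trans: "le u v \<Longrightarrow> le v w \<Longrightarrow> le u w"
  using le_iff_Fminus Fminus_mono by blast

lemma le_imp_l_le: "le u v \<Longrightarrow> l u \<le> l v"
  using le_iff_Fminus Fminus_le by blast

lemma le_imp_l_less: "le u v \<Longrightarrow> u \<noteq> v \<Longrightarrow> l u < l v"
  using le_iff_Fminus Fminus_le Fminus_max_unique by (metis less_eq_real_def)

text \<open>For the upper strata monotonicity comes from transitivity of the order, tested at the
  vertices of \<open>Fplus P l v\<close>.\<close>

lemma Fplus_mono:
  assumes "le u v"
  shows "Fplus P l v \<subseteq> Fplus P l u"
proof (rule polytope_subset_of_vertices)
  have v: "v extreme_point_of P" and u: "u extreme_point_of P" using assms le_vertex by blast+
  show "polytope (Fplus P l v)" using Fplus_face[OF v] polytope_P face_of_polytope_polytope by blast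
  show "convex (Fplus P l u)" using Fplus_face[OF u] face_of_imp_convex by blast
  fix x assume "x extreme_point_of Fplus P l v"
  then have "x extreme_point_of P" "x \<in> Fplus P l v"
    using Fplus_face[OF v] extreme_point_of_face by blast+
  then have "le u x" using assms le_iff_Fplus le_trans v by blast
  then show "x \<in> Fplus P l u" using le_iff_Fplus by blast
qed

lemma Fminus_mono_le: "le u v \<Longrightarrow> Fminus P l u \<subseteq> Fminus P l v"
  using le_iff_Fminus Fminus_mono by blast

section \<open>The faces \<open>Q v w\<close> and their splitting at an intermediate vertex\<close>

lemma Q_face: "le v w \<Longrightarrow> Q v w face_of P"
  unfolding Q_def using le_vertex by (intro face_of_Int Fplus_face Fminus_face) blast+

lemma Q_polytope: "le v w \<Longrightarrow> polytope (Q v w)"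
  using Q_face polytope_P face_of_polytope_polytope by blast

lemma ends_in_Q: "le v w \<Longrightarrow> v \<in> Q v w" "le v w \<Longrightarrow> w \<in> Q v w"
  unfolding Q_def using le_iff_Fminus le_iff_Fplus self_in_Fminus self_in_Fplus by blast+

lemma l_bounds_Q: "x \<in> Q v w \<Longrightarrow> l v \<le> l x" "x \<in> Q v w \<Longrightarrow> l x \<le> l w"
  unfolding Q_def using Fminus_le Fplus_ge by blast+

lemma Q_min_unique: "le v w \<Longrightarrow> x \<in> Q v w \<Longrightarrow> l x = l v \<Longrightarrow> x = v"
  unfolding Q_def using Fplus_min_unique le_vertex by blast

lemma Q_max_unique: "le v w \<Longrightarrow> x \<in> Q v w \<Longrightarrow> l x = l w \<Longrightarrow> x = w"
  unfolding Q_def using Fminus_max_unique le_vertex by blast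

lemma Q_self: "v extreme_point_of P \<Longrightarrow> Q v v = {v}"
  using le_refl ends_in_Q(1) l_bounds_Q[of _ v v] Q_min_unique[of v v] by force

lemma Q_mono: "le v' v \<Longrightarrow> le w w' \<Longrightarrow> Q v w \<subseteq> Q v' w'"
  unfolding Q_def using Fplus_mono Fminus_mono_le by blast

lemma faces_between_Q: "F \<in> faces_between P l v w \<Longrightarrow> F face_of P \<and> F \<subseteq> Q v w"
  unfolding Q_def faces_between_def using subset_Fminus subset_Fplus by blast

lemma faces_between_iff:
  assumes "le v w"
  shows "F \<in> faces_between P l v w \<longleftrightarrow> F face_of Q v w \<and> v \<in> F \<and> w \<in> F"
proof
  assume "F \<in> faces_between P l v w"
  then show "F face_of Q v w \<and> v \<in> F \<and> w \<in> F"
    using faces_between_Q[of F v w] Q_face[OF assms] face_of_face by (auto simp: faces_between_def)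
next
  assume "F face_of Q v w \<and> v \<in> F \<and> w \<in> F"
  then show "F \<in> faces_between P l v w"
    using l_bounds_Q face_of_imp_subset Q_face[OF assms] face_of_trans unfolding faces_between_def by blast
qed

lemma vertex_of_Q: "le v w \<Longrightarrow> x extreme_point_of Q v w \<longleftrightarrow> le v x \<and> le x w"
  using extreme_point_of_face[OF Q_face] le_iff_Fminus le_iff_Fplus le_vertex unfolding Q_def by blast

lemma Q_edge_cases:
  assumes "le v u" "le u w" "E edge_of Q v w" "u \<in> E"
  shows "E \<subseteq> Q v u \<or> E \<subseteq> Q u w"
proof -
  have vw: "le v w" using assms le_trans by blast
  have "E edge_of P" using assms(3) Q_face[OF vw] edge_of_face by blast
  then have "E \<subseteq> Fminus P l u \<or> E \<subseteq> Fplus P l u"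
    using edge_in_Fminus_or_Fplus assms le_vertex by blast
  moreover have "E \<subseteq> Q v w" using assms(3) edge_of_imp_subset by blast
  ultimately show ?thesis unfolding Q_def by blast
qed

text \<open>Minimality at the vertex \<open>u\<close> is decided by the edges at \<open>u\<close>,
  and each of them lies in one of the two parts.\<close>

lemma Q_linear_ge:
  assumes "le v u" "le u w" and h: "linear h"
    and "\<And>x. x \<in> Q v u \<Longrightarrow> h u \<le> h x" "\<And>x. x \<in> Q u w \<Longrightarrow> h u \<le> h x" "x \<in> Q v w"
  shows "h u \<le> (h x :: real)"
proof (rule vertex_minimal_of_edges[OF _ _ h _ assms(6)])
  have vw: "le v w" using assms le_trans by blast
  show "polytope (Q v w)" using vw Q_polytope by blast
  show "u extreme_point_of Q v w" using vertex_of_Q vw assms by blast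
  show "h u \<le> h y" if "E edge_of Q v w" "u \<in> E" "y \<in> E" for E y
    using Q_edge_cases[OF assms(1,2) that(1,2)] that(3) assms(4,5) by blast
qed

text \<open>Serves to recognise the minimal face of a functional from its traces on the two parts:
  an edge of \<open>Z\<close> at \<open>u\<close> lies in one of the parts, hence in
  \<open>F\<close>.\<close>

lemma Q_face_eq:
  assumes "le v u" "le u w" and Z: "Z face_of Q v w" and F: "F face_of Z" "u \<in> F"
    and "Z \<inter> Q v u \<subseteq> F" "Z \<inter> Q u w \<subseteq> F"
  shows "F = Z"
proof (rule face_eq_of_edges[OF _ F(1) _ F(2)])
  have vw: "le v w" using assms le_trans by blast
  show "polytope Z" using vw Q_polytope Z face_of_polytope_polytope by blast
  have "u extreme_point_of Q v w" using vertex_of_Q vw assms by blast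
  then show "u extreme_point_of Z" using Z F extreme_point_of_face face_of_imp_subset by blast
  show "E \<subseteq> F" if "E edge_of Z" "u \<in> E" for E
  proof -
    have "E edge_of Q v w" using that(1) Z unfolding edge_of_def by (meson face_of_trans)
    then have "E \<subseteq> Q v u \<or> E \<subseteq> Q u w" using Q_edge_cases assms(1,2) that(2) by blast
    moreover have "E \<subseteq> Z" using that(1) edge_of_imp_subset by blast
    ultimately show ?thesis using assms(6,7) by blast
  qed
qed

text \<open>Otherwise some functional vanishes on both direction spaces but not on some
  \<open>x - u\<close>. It is constant on both parts, so it and its negative are both minimal at
  \<open>u\<close> on all of \<open>Q v w\<close>, and it cannot separate \<open>x\<close> from
  \<open>u\<close>.\<close>

lemma dirs_Q_subset:
  assumes "le v u" "le u w"
  shows "dirs (Q v w) \<subseteq> {x + y |x y. x \<in> dirs (Q v u) \<and> y \<in> dirs (Q u w)}" (is "_ \<subseteq> ?W")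
proof -
  have W: "subspace ?W" by (intro subspace_sums) auto
  have vw: "le v w" using assms le_trans by blast
  have uQ: "u \<in> Q v u" "u \<in> Q u w" "u \<in> Q v w"
    using ends_in_Q assms Q_mono[of v v u w] le_refl le_vertex by blast+
  have inW: "x - u \<in> ?W" if "x \<in> Q v u \<or> x \<in> Q u w" for x
  proof -
    have "x - u = (x - u) + 0" "x - u = 0 + (x - u)" "0 \<in> dirs (Q v u)" "0 \<in> dirs (Q u w)"
      by (auto intro: subspace_0)
    then show ?thesis using that uQ diff_in_dirs by blast
  qed
  have "x - u \<in> ?W" if x: "x \<in> Q v w" for x
  proof (rule ccontr)
    assume "x - u \<notin> ?W"
    then obtain h :: "'a \<Rightarrow> real" where h: "linear h" "\<And>y. y \<in> ?W \<Longrightarrow> h y = 0" "h (x - u) \<noteq> 0"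
      using not_in_subspace_functional[OF W] by blast
    have eq: "h y = h u" if "y \<in> Q v u \<or> y \<in> Q u w" for y
      using h(2)[OF inW[OF that]] h(1) by (simp add: linear_diff)
    have nh: "linear (\<lambda>x. - h x)" using h(1) by (rule linear_compose_neg)
    have "h u \<le> h x" using Q_linear_ge[OF assms h(1) _ _ x] eq by auto
    moreover have "- h u \<le> - h x" using Q_linear_ge[OF assms nh _ _ x] eq by auto
    ultimately show False using h(1,3) by (simp add: linear_diff)
  qed
  then show ?thesis unfolding dirs_eq_span[OF uQ(3)] using W by (intro span_minimal) auto
qed

section \<open>Dimension of \<open>Q v w\<close> and its additivity\<close>

definition rk :: "'a \<Rightarrow> 'a \<Rightarrow> nat" where
  "rk v w = dim (dirs (Q v w))"

lemma rk_le: "le v u \<Longrightarrow> le u w \<Longrightarrow> rk v w \<le> rk v u + rk u w"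
proof -
  assume *: "le v u" "le u w"
  have "rk v w \<le> dim {x + y |x y. x \<in> dirs (Q v u) \<and> y \<in> dirs (Q u w)}"
    unfolding rk_def by (rule dim_subset[OF dirs_Q_subset[OF *]])
  also have "\<dots> \<le> rk v u + rk u w"
    unfolding rk_def using dim_sums_Int[of "dirs (Q v u)" "dirs (Q u w)"] by simp
  finally show ?thesis .
qed

lemma rk_less:
  assumes "le v u" "le u w" "u \<noteq> w"
  shows "rk v u < rk v w"
proof -
  have vw: "le v w" using assms le_trans by blast
  have ne: "Q v u \<noteq> {}" "Q v w \<noteq> {}" using assms vw ends_in_Q by blast+
  have sub: "Q v u \<subseteq> Q v w" using Q_mono assms le_refl le_vertex by blast
  then have "Q v u face_of Q v w" using Q_face[OF vw] Q_face[OF assms(1)] face_of_face by blast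
  moreover have "Q v u \<noteq> Q v w"
    using ends_in_Q(2)[OF vw] l_bounds_Q(2)[of w v u] le_imp_l_less[OF assms(2,3)] by force
  ultimately have "aff_dim (Q v u) < aff_dim (Q v w)"
    using face_of_aff_dim_lt Q_polytope[OF vw] polytope_imp_convex by blast
  then show ?thesis using ne by (simp add: aff_dim_dirs rk_def)
qed

lemma rk_self: "v extreme_point_of P \<Longrightarrow> rk v v = 0"
  using aff_dim_dirs[of "{v}"] by (simp add: rk_def Q_self)

text \<open>The vertices of \<open>Q u w\<close> are the elements of the interval, so over a cover
  it is the segment from \<open>u\<close> to \<open>w\<close>.\<close>

lemma rk_cover:
  assumes "le u w" "u \<noteq> w" "\<And>x. le u x \<Longrightarrow> le x w \<Longrightarrow> x = u \<or> x = w"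
  shows "rk u w = 1"
proof -
  have "Q u w = convex hull {x. x extreme_point_of Q u w}"
    using assms Q_polytope by (intro Krein_Milman_Minkowski polytope_imp_compact polytope_imp_convex)
  also have "{x. x extreme_point_of Q u w} = {u, w}"
    using assms vertex_of_Q[OF assms(1)] le_refl le_vertex by blast
  finally have "aff_dim (Q u w) = aff_dim {u, w}" by (simp add: aff_dim_convex_hull)
  also have "\<dots> = 1" using assms(2) by (simp add: aff_dim_2)
  finally show ?thesis using aff_dim_dirs[of "Q u w"] ends_in_Q[OF assms(1)] by (auto simp: rk_def)
qed

lemma cover_exists:
  assumes "le u w" "u \<noteq> w"
  obtains w' where "le u w'" "le w' w" "w' \<noteq> w" "\<And>x. le w' x \<Longrightarrow> le x w \<Longrightarrow> x = w' \<or> x = w"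
proof -
  let ?S = "{x. le u x \<and> le x w \<and> x \<noteq> w}"
  have fin: "finite ?S"
    by (rule finite_subset[OF _ finite_vertices[OF polytope_P]]) (use le_vertex in blast)
  have ne: "u \<in> ?S" using assms le_refl le_vertex by blast
  obtain w' where w': "w' \<in> ?S" "l w' = Max (l ` ?S)"
    using Max_in[of "l ` ?S"] fin ne by (metis (no_types, lifting) empty_iff finite_imageI imageE image_is_empty)
  show thesis
  proof (rule that)
    show "le u w'" "le w' w" "w' \<noteq> w" using w' by auto
    fix x assume x: "le w' x" "le x w"
    show "x = w' \<or> x = w"
    proof (rule ccontr)
      assume n: "\<not> ?thesis"
      then have "x \<in> ?S" using x w'(1) le_trans by blast
      then have "l x \<le> l w'" using w'(2) fin by simp
      then show False using le_imp_l_less[OF x(1)] n by force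
    qed
  qed
qed

text \<open>Reach \<open>w\<close> through a cover from \<open>w'\<close>. In this step the ranks
  over \<open>v\<close> and over \<open>u\<close> both grow strictly by \<open>rk_less\<close>, and
  by at most 1 by \<open>rk_le\<close> and \<open>rk_cover\<close>, so they grow together.\<close>

lemma rk_add:
  assumes "le v u" "le u w"
  shows "rk v w = rk v u + rk u w"
  using assms(2)
proof (induction "card {x. x extreme_point_of P \<and> l x < l w}" arbitrary: w rule: less_induct)
  case less
  show ?case
  proof (cases "u = w")
    case True
    then show ?thesis using rk_self less.prems le_vertex by simp
  next
    case False
    then obtain w' where w': "le u w'" "le w' w" "w' \<noteq> w"
      "\<And>x. le w' x \<Longrightarrow> le x w \<Longrightarrow> x = w' \<or> x = w"
      using cover_exists less.prems by blast
    have vw': "le v w'" using w' assms(1) le_trans by blast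
    have "{x. x extreme_point_of P \<and> l x < l w'} \<subset> {x. x extreme_point_of P \<and> l x < l w}"
      using le_imp_l_less[OF w'(2,3)] le_vertex[OF w'(2)] by force
    then have "card {x. x extreme_point_of P \<and> l x < l w'} < card {x. x extreme_point_of P \<and> l x < l w}"
      using finite_vertices[OF polytope_P] by (intro psubset_card_mono) auto
    then have IH: "rk v w' = rk v u + rk u w'" using less.hyps w'(1) by blast
    have c: "rk w' w = 1" using rk_cover w' by blast
    have "rk v w = rk v w' + 1"
      using rk_less[OF vw' w'(2,3)] rk_le[OF vw' w'(2)] c by simp
    moreover have "rk u w = rk u w' + 1"
      using rk_less[OF w'(1,2,3)] rk_le[OF w'(1,2)] c by simp
    ultimately show ?thesis using IH by simp
  qed
qed

text \<open>The sum of the two spaces contains \<open>dirs (Q v w)\<close>, whose dimension is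
  already the sum of theirs, so nothing is left for the intersection.\<close>

lemma dirs_Q_Int:
  assumes "le v u" "le u w"
  shows "dirs (Q v u) \<inter> dirs (Q u w) = {0}"
proof -
  let ?S = "{x + y |x y. x \<in> dirs (Q v u) \<and> y \<in> dirs (Q u w)}"
  have "rk v w \<le> dim ?S" unfolding rk_def by (rule dim_subset[OF dirs_Q_subset[OF assms]])
  moreover have "dim ?S + dim (dirs (Q v u) \<inter> dirs (Q u w)) = rk v u + rk u w"
    unfolding rk_def by (intro dim_sums_Int) auto
  ultimately have "dim (dirs (Q v u) \<inter> dirs (Q u w)) = 0" using rk_add[OF assms] by linarith
  then have "dirs (Q v u) \<inter> dirs (Q u w) \<subseteq> {0}" by (simp only: dim_eq_0)
  then show ?thesis by (auto intro: subspace_0)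
qed

end

subsection \<open>Cellular strings and their coherence\<close>

lemma large_multiple_positive:
  fixes a b :: "'i \<Rightarrow> real"
  assumes "finite A" "\<And>i. i \<in> A \<Longrightarrow> b i > 0"
  shows "eventually (\<lambda>K. \<forall>i\<in>A. a i + K * b i > 0) at_top"
proof (rule eventually_ball_finite[OF assms(1)], rule)
  fix i assume i: "i \<in> A"
  show "eventually (\<lambda>K. a i + K * b i > 0) at_top"
    using eventually_gt_at_top[of "- a i / b i"]
  proof eventually_elim
    case (elim K)
    then show ?case using assms(2)[OF i] by (simp add: field_simps)
  qed
qed

context stratified_polytope
begin

text \<open>The condition \<open>u \<noteq> v\<close> excludes vertices as cells. Intermediate
  vertices are not recorded, as a cell determines its own ends by
  \<open>faces_between_ends_unique\<close>. Only the empty list is a string from a vertex to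
  itself.\<close>

fun cstring :: "'a \<Rightarrow> 'a \<Rightarrow> 'a set list \<Rightarrow> bool" where
  "cstring v w [] \<longleftrightarrow> v = w \<and> v extreme_point_of P"
| "cstring v w (F # Fs) \<longleftrightarrow> (\<exists>u. le v u \<and> u \<noteq> v \<and> F \<in> faces_between P l v u \<and> cstring u w Fs)"

lemma cstring_le: "cstring v w Fs \<Longrightarrow> le v w"
  by (induction Fs arbitrary: v) (auto intro: le_refl le_trans)

lemma cstring_member:
  "cstring v w Fs \<Longrightarrow> F \<in> set Fs \<Longrightarrow>
    \<exists>a b. le v a \<and> le a b \<and> a \<noteq> b \<and> le b w \<and> F \<in> faces_between P l a b"
proof (induction Fs arbitrary: v)
  case (Cons G Fs)
  then obtain u where u: "le v u" "u \<noteq> v" "G \<in> faces_between P l v u" "cstring u w Fs" by auto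
  show ?case
  proof (cases "F = G")
    case True
    then show ?thesis using u cstring_le le_refl le_vertex(1) by blast
  next
    case False
    then have "F \<in> set Fs" using Cons.prems by simp
    then show ?thesis using Cons.IH[OF u(4)] u(1) le_trans by blast
  qed
qed simp

text \<open>\<open>coherent v w g Fs\<close> says that the image of each cell of \<open>Fs\<close> under \<open>(l, g)\<close> is an edge of
  the lower boundary of the polygon \<open>(l, g) ` Q v w\<close>, and that the cell is its full preimage.\<close>

definition coherent :: "'a \<Rightarrow> 'a \<Rightarrow> ('a \<Rightarrow> real) \<Rightarrow> 'a set list \<Rightarrow> bool" where
  "coherent v w g Fs \<longleftrightarrow>
     (\<forall>F\<in>set Fs. \<exists>c d. \<forall>x\<in>Q v w. c * l x + d \<le> g x \<and> (g x = c * l x + d \<longleftrightarrow> x \<in> F))"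

text \<open>Prepending a cell \<open>F\<close> from \<open>v\<close> to \<open>u\<close>: as the directions of \<open>Q v u\<close> and \<open>Q u w\<close> are
  independent, \<open>g\<close> may be redefined on \<open>Q v u\<close> as a functional exposing \<open>F\<close> minus a multiple
  of \<open>l\<close>. A large multiple makes the slope over \<open>F\<close> smaller than all other slopes.\<close>

lemma coherent_exists:
  "cstring v w Fs \<Longrightarrow> \<exists>g. linear g \<and> coherent v w g Fs"
proof (induction Fs arbitrary: v)
  case Nil
  have "linear (\<lambda>x::'a. 0 :: real)" by (rule linear_zero)
  then show ?case unfolding coherent_def by auto
next
  case (Cons F Fs)
  then obtain u where u: "le v u" "u \<noteq> v" "F \<in> faces_between P l v u" "cstring u w Fs" by auto
  have uw: "le u w" and vw: "le v w" using u cstring_le le_trans by blast+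
  note lin = linear_diff linear_add linear_scale
  obtain g where g: "linear g" "coherent u w g Fs" using Cons.IH[OF u(4)] by blast
  have "\<forall>G\<in>set Fs. \<exists>p. \<forall>x\<in>Q u w. fst p * l x + snd p \<le> g x \<and> (g x = fst p * l x + snd p \<longleftrightarrow> x \<in> G)"
    using g(2) unfolding coherent_def by simp
  then obtain p where p: "\<And>G x. G \<in> set Fs \<Longrightarrow> x \<in> Q u w \<Longrightarrow>
      fst (p G) * l x + snd (p G) \<le> g x \<and> (g x = fst (p G) * l x + snd (p G) \<longleftrightarrow> x \<in> G)"
    by metis
  have uQ: "u \<in> Q v u" "u \<in> Q u w" "u \<in> Q v w"
    using ends_in_Q u(1) uw Q_mono[OF le_refl uw, of v] le_vertex by blast+
  have sub: "Q v u \<subseteq> Q v w" "Q u w \<subseteq> Q v w"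
    using Q_mono u(1) uw le_refl le_vertex by blast+
  have F: "F face_of Q v u" "v \<in> F" "u \<in> F" using u(3) faces_between_iff[OF u(1)] by blast+
  obtain \<alpha> :: "'a \<Rightarrow> real" and m where \<alpha>: "linear \<alpha>" "\<And>x. x \<in> Q v u \<Longrightarrow> m \<le> \<alpha> x"
      "\<And>x. x \<in> Q v u \<Longrightarrow> \<alpha> x = m \<longleftrightarrow> x \<in> F"
    using exposing_functional[OF Q_polytope[OF u(1)] F(1)] F(2) by blast
  have \<alpha>u: "\<alpha> u = m" using \<alpha>(3) uQ F by blast
  obtain g0 where g0: "linear g0" "\<And>x. x \<in> dirs (Q v u) \<Longrightarrow> g0 x = \<alpha> x"
      "\<And>x. x \<in> dirs (Q u w) \<Longrightarrow> g0 x = g x"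
    using linear_extension_two[OF subspace_dirs subspace_dirs dirs_Q_Int[OF u(1) uw] \<alpha>(1) g(1)] by blast
  have nl: "linear (\<lambda>x. - l x)" using linear_l by (rule linear_compose_neg)
  have zl: "linear (\<lambda>x::'a. 0 :: real)" by (rule linear_zero)
  \<comment> \<open>\<open>h\<close> tilts the lower part and leaves the upper one alone: adding
    \<open>K * h\<close> lowers every slope over \<open>Q v u\<close> by \<open>K\<close>.\<close>
  obtain h where h: "linear h" "\<And>x. x \<in> dirs (Q v u) \<Longrightarrow> h x = - l x"
      "\<And>x. x \<in> dirs (Q u w) \<Longrightarrow> h x = 0"
    using linear_extension_two[OF subspace_dirs subspace_dirs dirs_Q_Int[OF u(1) uw] nl zl] by blast
  have g0v: "g0 x - g0 u = \<alpha> x - m" if "x \<in> Q v u" for x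
    using g0(2)[OF diff_in_dirs[OF that uQ(1)]] g0(1) \<alpha>(1) \<alpha>u by (simp add: lin)
  have g0w: "g0 x - g0 u = g x - g u" if "x \<in> Q u w" for x
    using g0(3)[OF diff_in_dirs[OF that uQ(2)]] g0(1) g(1) by (simp add: lin)
  have hv: "h x - h u = l u - l x" if "x \<in> Q v u" for x
    using h(2)[OF diff_in_dirs[OF that uQ(1)]] h(1) linear_l by (simp add: lin)
  have hw: "h x = h u" if "x \<in> Q u w" for x
    using h(3)[OF diff_in_dirs[OF that uQ(2)]] h(1) by (simp add: lin)
  have hge: "h u \<le> h x" if "x \<in> Q v w" for x
  proof (rule Q_linear_ge[OF u(1) uw h(1) _ _ that])
    show "h u \<le> h y" if "y \<in> Q v u" for y using hv[OF that] l_bounds_Q[OF that] by simp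
  qed (simp add: hw)
  \<comment> \<open>As \<open>h\<close> is minimal exactly on \<open>Q u w\<close>, every vertex
    elsewhere has a positive gap, which a large \<open>K\<close> can stretch beyond the lines of the
    old cells.\<close>
  have "Q u w = {x\<in>Q v w. h x = h u}"
  proof (rule Q_face_eq[OF u(1) uw])
    show Z: "{x \<in> Q v w. h x = h u} face_of Q v w"
      using h(1) hge Q_polytope[OF vw] by (intro linear_minimum_face polytope_imp_convex)
    show "Q u w face_of {x \<in> Q v w. h x = h u}"
      using face_of_face[OF Z] sub(2) hw Q_face[OF uw] Q_face[OF vw] face_of_face by blast
    show "{x \<in> Q v w. h x = h u} \<inter> Q v u \<subseteq> Q u w"
    proof
      fix x assume x: "x \<in> {x \<in> Q v w. h x = h u} \<inter> Q v u"
      then have "l x = l u" using hv[of x] by simp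
      then have "x = u" using Q_max_unique[OF u(1)] x by blast
      then show "x \<in> Q u w" using uQ by blast
    qed
  qed (use uQ in auto)
  then have hpos: "h x - h u > 0" if "x \<in> Q v w" "x \<notin> Q u w" for x
    using hge[OF that(1)] that by force
  let ?V = "{x. x extreme_point_of Q v w}"
  have finV: "finite ?V" using finite_vertices Q_polytope[OF vw] by blast
  have VQ: "x \<in> Q v w" if "x \<in> ?V" for x using that extreme_point_of_def by blast
  \<comment> \<open>\<open>K\<close> has to meet two demands. Vertices outside \<open>Q u w\<close>
    must rise strictly above the line of each old cell, and from \<open>u\<close> to any other
    vertex of \<open>Q u w\<close> the slope of \<open>g\<close> must exceed \<open>-K\<close>, the
    slope of the new cell.\<close>
  have "eventually (\<lambda>K. \<forall>i\<in>{x\<in>?V. x \<notin> Q u w} \<times> set Fs.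
      (g0 (fst i) - g0 u + g u - fst (p (snd i)) * l (fst i) - snd (p (snd i)))
        + K * (h (fst i) - h u) > 0) at_top"
    using finV hpos VQ by (intro large_multiple_positive) auto
  moreover have "eventually (\<lambda>K. \<forall>x\<in>{x\<in>?V. x \<in> Q u w \<and> x \<noteq> u}. (g x - g u) + K * (l x - l u) > 0) at_top"
  proof (rule large_multiple_positive)
    show "l x - l u > 0" if "x \<in> {x\<in>?V. x \<in> Q u w \<and> x \<noteq> u}" for x
      using that l_bounds_Q(1)[of x u w] Q_min_unique[OF uw, of x] by force
  qed (use finV in auto)
  ultimately have "eventually (\<lambda>K. (\<forall>i\<in>{x\<in>?V. x \<notin> Q u w} \<times> set Fs.
      (g0 (fst i) - g0 u + g u - fst (p (snd i)) * l (fst i) - snd (p (snd i)))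
        + K * (h (fst i) - h u) > 0) \<and>
      (\<forall>x\<in>{x\<in>?V. x \<in> Q u w \<and> x \<noteq> u}. (g x - g u) + K * (l x - l u) > 0)) at_top"
    by (rule eventually_conj)
  from eventually_happens'[OF trivial_limit_at_top_linorder this] obtain K where
    K1: "\<And>x G. x \<in> ?V \<Longrightarrow> x \<notin> Q u w \<Longrightarrow> G \<in> set Fs \<Longrightarrow>
       (g0 x - g0 u + g u - fst (p G) * l x - snd (p G)) + K * (h x - h u) > 0" and
    K2: "\<And>x. x \<in> ?V \<Longrightarrow> x \<in> Q u w \<Longrightarrow> x \<noteq> u \<Longrightarrow> (g x - g u) + K * (l x - l u) > 0"
    by fastforce
  define g' where "g' = (\<lambda>x. g0 x + K * h x)"
  have g': "linear g'"
    using linear_compose_add[OF g0(1) linear_compose_scale_right[OF h(1), of K]] by (simp add: g'_def)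
  \<comment> \<open>On \<open>Q u w\<close> the new functional is \<open>g\<close> lowered by the
    constant \<open>e\<close>, so the lines of the old cells have to be lowered by \<open>e\<close>
    as well.\<close>
  define e where "e = g u - g0 u - K * h u"
  have g'e: "g' x + e = g x" if "x \<in> Q u w" for x
    using g0w[OF that] hw[OF that] by (simp add: g'_def e_def algebra_simps)
  have lin_k: "linear (\<lambda>x. g' x - c * l x)" for c
    using linear_compose_sub[OF g' linear_compose_scale_right[OF linear_l, of c]] by simp
  have newcell: "\<exists>c d. \<forall>x\<in>Q v w. c * l x + d \<le> g' x \<and> (g' x = c * l x + d \<longleftrightarrow> x \<in> F)"
  proof -
    \<comment> \<open>With slope \<open>-K\<close>, \<open>?k\<close> agrees with
      \<open>\<alpha>\<close> on \<open>Q v u\<close> up to a constant, so \<open>F\<close> is its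
      set of minimisers there.\<close>
    let ?k = "\<lambda>x. g' x - (- K) * l x"
    have kv: "?k x - ?k u = \<alpha> x - m" if "x \<in> Q v u" for x
    proof -
      have "?k x - ?k u = (g0 x - g0 u) + K * (h x - h u) + K * (l x - l u)"
        by (simp add: g'_def algebra_simps)
      then show ?thesis using g0v[OF that] hv[OF that] by (simp add: algebra_simps)
    qed
    have kw: "?k x - ?k u = (g x - g u) + K * (l x - l u)" if "x \<in> Q u w" for x
      using g'e[OF that] g'e[OF uQ(2)] by (simp add: algebra_simps)
    have V': "x \<in> ?V \<and> x \<in> Q u w" if "x extreme_point_of Q u w" for x
      using that vertex_of_Q[OF uw] vertex_of_Q[OF vw] u(1) le_trans extreme_point_of_def by blast
    have kge_w: "?k u \<le> ?k x" if "x \<in> Q u w" for x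
    proof (rule linear_ge_of_vertices[OF Q_polytope[OF uw] lin_k _ that])
      fix y assume "y extreme_point_of Q u w"
      then show "?k u \<le> ?k y" using V'[of y] K2[of y] kw[of y] by (cases "y = u") auto
    qed
    have kge: "?k u \<le> ?k x" if "x \<in> Q v w" for x
    proof (rule Q_linear_ge[OF u(1) uw lin_k _ kge_w that])
      show "?k u \<le> ?k y" if "y \<in> Q v u" for y using kv[OF that] \<alpha>(2)[OF that] by linarith
    qed
    have "F = {x\<in>Q v w. ?k x = ?k u}" (is "_ = ?Z")
    proof (rule Q_face_eq[OF u(1) uw])
      show Z: "?Z face_of Q v w"
        using lin_k kge Q_polytope[OF vw] by (intro linear_minimum_face polytope_imp_convex)
      have "x \<in> ?Z" if "x \<in> F" for x
      proof -
        have x: "x \<in> Q v u" using that F face_of_imp_subset by blast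
        then have "\<alpha> x = m" using that \<alpha>(3) by blast
        then show ?thesis using kv[OF x] x sub by auto
      qed
      then have "F \<subseteq> ?Z" by blast
      moreover have "F face_of Q v w"
        using F(1) Q_face[OF u(1)] Q_face[OF vw] face_of_face face_of_trans sub(1) face_of_imp_subset
        by (meson subset_trans)
      ultimately show "F face_of ?Z" using face_of_face[OF Z] by blast
      show "u \<in> F" by fact
      show "?Z \<inter> Q v u \<subseteq> F"
      proof
        fix x assume x: "x \<in> ?Z \<inter> Q v u"
        then have "\<alpha> x = m" using kv[of x] by auto
        then show "x \<in> F" using \<alpha>(3) x by blast
      qed
      have Zw: "{x\<in>Q u w. ?k x = ?k u} face_of Q u w"
        using lin_k kge_w Q_polytope[OF uw] by (intro linear_minimum_face polytope_imp_convex)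
      have "{x\<in>Q u w. ?k x = ?k u} \<subseteq> {u}"
      proof (rule polytope_subset_of_vertices)
        show "polytope {x\<in>Q u w. ?k x = ?k u}" using Zw Q_polytope[OF uw] face_of_polytope_polytope by blast
        fix x assume "x extreme_point_of {x\<in>Q u w. ?k x = ?k u}"
        then have x: "x extreme_point_of Q u w" "?k x = ?k u" using extreme_point_of_face[OF Zw] by auto
        then show "x \<in> {u}" using V'[OF x(1)] K2[of x] kw[of x] by auto
      qed simp
      then show "?Z \<inter> Q u w \<subseteq> F" using F by blast
    qed
    then have "x \<in> F \<longleftrightarrow> ?k x = ?k u" if "x \<in> Q v w" for x using that by blast
    then have "\<forall>x\<in>Q v w. (- K) * l x + ?k u \<le> g' x \<and> (g' x = (- K) * l x + ?k u \<longleftrightarrow> x \<in> F)"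
      using kge by (smt (verit))
    then show ?thesis by blast
  qed
  have oldcell: "\<exists>c d. \<forall>x\<in>Q v w. c * l x + d \<le> g' x \<and> (g' x = c * l x + d \<longleftrightarrow> x \<in> G)" if G: "G \<in> set Fs" for G
  proof -
    obtain c d where cd: "p G = (c, d)" by (cases "p G")
    let ?k = "\<lambda>x. g' x - c * l x"
    have kw: "d - e \<le> ?k x \<and> (?k x = d - e \<longleftrightarrow> x \<in> G)" if "x \<in> Q u w" for x
      using p[OF G that] g'e[OF that] cd by auto
    have kout: "d - e < ?k x" if "x \<in> ?V" "x \<notin> Q u w" for x
      using K1[OF that G] cd by (simp add: g'_def e_def algebra_simps)
    have kge: "d - e \<le> ?k x" if "x \<in> Q v w" for x
    proof (rule linear_ge_of_vertices[OF Q_polytope[OF vw] lin_k _ that])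
      show "d - e \<le> ?k y" if "y extreme_point_of Q v w" for y
        using kw[of y] kout[of y] that by (cases "y \<in> Q u w") auto
    qed
    let ?Z = "{x\<in>Q v w. ?k x = d - e}"
    have Z: "?Z face_of Q v w"
      using lin_k kge Q_polytope[OF vw] by (intro linear_minimum_face polytope_imp_convex)
    have Gw: "G \<subseteq> Q u w" "convex G"
    proof -
      obtain a b where "le u a" "le a b" "le b w" "G \<in> faces_between P l a b"
        using cstring_member[OF u(4) G] by blast
      then show "G \<subseteq> Q u w" "convex G"
        using faces_between_Q[of G a b] Q_mono face_of_imp_convex by blast+
    qed
    have "?Z \<subseteq> G"
    proof (rule polytope_subset_of_vertices[OF _ Gw(2)])
      show "polytope ?Z" using Z Q_polytope[OF vw] face_of_polytope_polytope by blast
      fix x assume "x extreme_point_of ?Z"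
      then have x: "x \<in> ?V" "?k x = d - e" using extreme_point_of_face[OF Z] by auto
      then have "x \<in> Q u w" using kout[of x] by force
      then show "x \<in> G" using kw x by blast
    qed
    moreover have "G \<subseteq> ?Z" using Gw(1) kw sub(2) by blast
    ultimately have "x \<in> G \<longleftrightarrow> ?k x = d - e" if "x \<in> Q v w" for x using that by blast
    then have "\<forall>x\<in>Q v w. c * l x + (d - e) \<le> g' x \<and> (g' x = c * l x + (d - e) \<longleftrightarrow> x \<in> G)"
      using kge by (smt (verit))
    then show ?thesis by blast
  qed
  have "coherent v w g' (F # Fs)" unfolding coherent_def using newcell oldcell by simp
  then show ?case using g' by blast
qed

text \<open>Conversely, the lower boundary of \<open>(l, g) ` Q v w\<close> is traced from left to right by always
  taking the smallest slope from the current vertex \<open>u\<close>; \<open>c0\<close> is the slope of the previous edge.\<close>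

lemma lower_boundary_from:
  assumes vw: "le v w" and g: "linear g"
  shows "le v u \<Longrightarrow> le u w \<Longrightarrow>
    (\<And>x. x extreme_point_of Q v w \<Longrightarrow> x \<noteq> u \<Longrightarrow> g u + c0 * (l x - l u) \<le> g x) \<Longrightarrow>
    (\<And>x. x extreme_point_of Q v w \<Longrightarrow> x \<noteq> u \<Longrightarrow> l u \<le> l x \<Longrightarrow> g u + c0 * (l x - l u) < g x) \<Longrightarrow>
    \<exists>Fs. cstring u w Fs \<and> coherent v w g Fs"
proof (induction "card {x. x extreme_point_of P \<and> l u < l x}" arbitrary: u c0 rule: less_induct)
  case less
  note u = less.prems(1,2) and below = less.prems(3) and above = less.prems(4)
  show ?case
  proof (cases "u = w")
    case True
    have "u extreme_point_of P" using le_vertex(1) u(2) by blast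
    then have "cstring u w []" using True by simp
    moreover have "coherent v w g []" by (simp add: coherent_def)
    ultimately show ?thesis by blast
  next
    case False
    let ?V = "{x. x extreme_point_of Q v w \<and> l u < l x}"
    let ?s = "\<lambda>x. (g x - g u) / (l x - l u)"
    define c where "c = Min (?s ` ?V)"
    have finV: "finite ?V" using finite_vertices[OF Q_polytope[OF vw]] by simp
    have "w \<in> ?V" using vertex_of_Q[OF vw] vw le_refl le_vertex le_imp_l_less[OF u(2) False] by blast
    then obtain z where z: "z \<in> ?V" "c = ?s z"
      using Min_in[of "?s ` ?V"] finV unfolding c_def by blast
    have cle: "c * (l x - l u) \<le> g x - g u" if "x \<in> ?V" for x
    proof -
      have "c \<le> ?s x" unfolding c_def using finV that by (intro Min_le) auto
      then show ?thesis using that by (simp add: pos_le_divide_eq)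
    qed
    \<comment> \<open>The new slope exceeds the previous one, which is convexity of the lower
      boundary. Hence the steeper line also stays below the vertices to the left of
      \<open>u\<close>.\<close>
    have "g u + c0 * (l z - l u) < g z" using above[of z] z by auto
    then have "c0 < c" using z by (simp add: pos_less_divide_eq)
    let ?k = "\<lambda>x. g x - c * l x"
    have k: "linear ?k"
      using linear_compose_sub[OF g linear_compose_scale_right[OF linear_l, of c]] by simp
    have klow: "?k u < ?k x" if "x extreme_point_of Q v w" "x \<noteq> u" "l x \<le> l u" for x
    proof (cases "l x = l u")
      case True
      then show ?thesis using above[OF that(1,2)] by simp
    next
      case False
      then have "c * (l x - l u) < c0 * (l x - l u)" using \<open>c0 < c\<close> that by simp
      then show ?thesis using below[OF that(1,2)] by (simp add: algebra_simps)
    qed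
    have kge: "?k u \<le> ?k x" if "x \<in> Q v w" for x
    proof (rule linear_ge_of_vertices[OF Q_polytope[OF vw] k _ that])
      fix y assume y: "y extreme_point_of Q v w"
      show "?k u \<le> ?k y"
      proof (cases "l u < l y")
        case True
        then show ?thesis using cle[of y] y by (simp add: algebra_simps)
      next
        case False
        then show ?thesis using klow[OF y] by (cases "y = u") auto
      qed
    qed
    define Z where "Z = {x\<in>Q v w. ?k x = ?k u}"
    have Z: "Z face_of Q v w"
      unfolding Z_def using k kge Q_polytope[OF vw] by (intro linear_minimum_face polytope_imp_convex)
    have ZP: "Z face_of P" "polytope Z"
      using Z Q_face[OF vw] face_of_trans polytope_P face_of_polytope_polytope by blast+
    have uV: "u extreme_point_of Q v w" using u vertex_of_Q[OF vw] by blast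
    then have uZ: "u \<in> Z" unfolding Z_def extreme_point_of_def by simp
    have zZ: "z \<in> Z"
      using z extreme_point_of_def[of z "Q v w"] by (auto simp: Z_def field_simps)
    have ZV: "x extreme_point_of Q v w \<and> x \<in> Z" if "x extreme_point_of Z" for x
      using that extreme_point_of_face[OF Z] by blast
    have Zge: "l u \<le> l x" if "x \<in> Z" for x
    proof (rule linear_ge_of_vertices[OF ZP(2) linear_l _ that])
      fix y assume "y extreme_point_of Z"
      then show "l u \<le> l y" using klow[of y] ZV[of y] unfolding Z_def by (smt (verit) mem_Collect_eq)
    qed
    obtain u' where u': "u' extreme_point_of Z" "\<And>x. x \<in> Z \<Longrightarrow> l x \<le> l u'"
      using maximal_vertex_exists[OF ZP(2) linear_l] uZ by blast
    have u'V: "u' extreme_point_of Q v w" "u' \<in> Z" using ZV[OF u'(1)] by auto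
    have vu': "le v u'" "le u' w" using u'V vertex_of_Q[OF vw] by blast+
    have lt: "l u < l u'" using z u'(2)[OF zZ] by simp
    have ku': "?k u' = ?k u" using u'V by (simp add: Z_def)
    have fb: "Z \<in> faces_between P l u u'"
      unfolding faces_between_def using ZP uZ u'V Zge u'(2) by blast
    then have uu': "le u u'" unfolding vertex_le_def using le_vertex u vu' by blast
    have "\<exists>Fs. cstring u' w Fs \<and> coherent v w g Fs"
    proof (rule less.hyps[OF _ vu'])
      have "{x. x extreme_point_of P \<and> l u' < l x} \<subset> {x. x extreme_point_of P \<and> l u < l x}"
        using lt le_vertex(1)[OF vu'(2)] by force
      then show "card {x. x extreme_point_of P \<and> l u' < l x} < card {x. x extreme_point_of P \<and> l u < l x}"
        using finite_vertices[OF polytope_P] by (intro psubset_card_mono) auto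
      fix x assume x: "x extreme_point_of Q v w" "x \<noteq> u'"
      have xQ: "x \<in> Q v w" using x extreme_point_of_def by blast
      show ge: "g u' + c * (l x - l u') \<le> g x" using kge[OF xQ] ku' by (simp add: algebra_simps)
      assume "l u' \<le> l x"
      \<comment> \<open>A vertex on the new line at the level of \<open>u'\<close> or beyond it
        would be a second maximum of \<open>l\<close> on \<open>Z\<close>.\<close>
      have "?k x \<noteq> ?k u"
      proof
        assume "?k x = ?k u"
        then have xZ: "x \<in> Z" using xQ by (simp add: Z_def)
        then have "l x = l u'" using u'(2) \<open>l u' \<le> l x\<close> by force
        then have "x = u'"
          using unique_maximum[OF polytope_P linear_l edge_nonconstant ZP(1) u'V(2) xZ u'(2)] by blast
        then show False using x by simp
      qed
      then show "g u' + c * (l x - l u') < g x" using kge[OF xQ] ku' by (simp add: algebra_simps)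
    qed
    then obtain Fs where Fs: "cstring u' w Fs" "coherent v w g Fs" by blast
    have "cstring u w (Z # Fs)" using Fs(1) fb uu' lt by auto
    moreover have "\<forall>x\<in>Q v w. c * l x + ?k u \<le> g x \<and> (g x = c * l x + ?k u \<longleftrightarrow> x \<in> Z)"
      using kge unfolding Z_def by (smt (verit) mem_Collect_eq)
    then have "coherent v w g (Z # Fs)" using Fs(2) unfolding coherent_def by auto
    ultimately show ?thesis by blast
  qed
qed

lemma lower_boundary:
  assumes vw: "le v w" and g: "linear g"
  obtains Fs where "cstring v w Fs" "coherent v w g Fs"
proof -
  let ?V = "{x. x extreme_point_of Q v w \<and> x \<noteq> v}"
  have finV: "finite ?V" using finite_vertices[OF Q_polytope[OF vw]] by simp
  have "l x - l v > 0" if "x \<in> ?V" for x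
    using that vertex_of_Q[OF vw] le_imp_l_less by force
  \<comment> \<open>A line descending steeply enough through \<open>v\<close> passes below all other
    vertices; it plays the part of the edge preceding the first one.\<close>
  then have "eventually (\<lambda>K. \<forall>x\<in>?V. (g x - g v) + K * (l x - l v) > 0) at_top"
    using finV by (intro large_multiple_positive) auto
  from eventually_happens'[OF trivial_limit_at_top_linorder this]
  obtain K where K: "\<And>x. x \<in> ?V \<Longrightarrow> (g x - g v) + K * (l x - l v) > 0"
    by blast
  have lt: "g v + (- K) * (l x - l v) < g x" if "x extreme_point_of Q v w" "x \<noteq> v" for x
    using K[of x] that by simp
  have "\<exists>Fs. cstring v w Fs \<and> coherent v w g Fs"
    using vw le_refl le_vertex lt less_imp_le[OF lt]
    by (intro lower_boundary_from[OF vw g, where ?c0.0 = "- K"]) blast+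
  then show thesis using that by blast
qed

end

subsection \<open>Monotone sections\<close>

text \<open>A functional vanishing on \<open>W\<close> can be taken under the integral, so it
  vanishes on the integral too.\<close>

lemma integral_in_subspace:
  fixes f :: "real \<Rightarrow> 'a::euclidean_space"
  assumes W: "subspace W" and f: "continuous_on {a..b} f" "\<And>t. t \<in> {a..b} \<Longrightarrow> f t \<in> W"
  shows "integral {a..b} f \<in> W"
proof (rule ccontr)
  assume "integral {a..b} f \<notin> W"
  then obtain h :: "'a \<Rightarrow> real" where h: "linear h" "\<And>y. y \<in> W \<Longrightarrow> h y = 0" "h (integral {a..b} f) \<noteq> 0"
    using not_in_subspace_functional[OF W] by blast
  have "h (integral {a..b} f) = integral {a..b} (h \<circ> f)"
    using integral_linear[OF integrable_continuous_real[OF f(1)]] h(1) linear_conv_bounded_linear by metis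
  also have "\<dots> = integral {a..b} (\<lambda>t. 0)"
    using h(2) f(2) by (intro integral_cong) auto
  finally show False using h(3) by simp
qed

lemma rel_interior_move:
  fixes F :: "'a::euclidean_space set"
  assumes "p \<in> rel_interior F" "z \<in> dirs F"
  obtains e where "e > 0" "p + e *\<^sub>R z \<in> F"
proof -
  have pF: "p \<in> F" using assms(1) rel_interior_subset by blast
  obtain d where d: "d > 0" "cball p d \<inter> affine hull F \<subseteq> F"
    using assms(1) by (auto simp: mem_rel_interior_cball)
  \<comment> \<open>The summand 1 keeps \<open>e\<close> positive when \<open>z = 0\<close> and
    still gives \<open>e * norm z \<le> d\<close>.\<close>
  define e where "e = d / (norm z + 1)"
  have np: "norm z + 1 > 0" by (simp add: add_nonneg_pos)
  have e0: "e > 0" using d np by (simp add: e_def)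
  have "e * norm z \<le> d" using d np by (simp add: e_def field_simps)
  then have "p + e *\<^sub>R z \<in> cball p d" using e0 by (simp add: dist_norm)
  moreover have "p + e *\<^sub>R z \<in> affine hull F"
  proof -
    have "affine hull F = (+) p ` span ((\<lambda>x. x - p) ` F)"
      using affine_hull_span_gen[of p F] pF hull_inc by (metis (no_types, lifting) diff_conv_add_uminus image_cong uminus_add_conv_diff)
    moreover have "e *\<^sub>R z \<in> span ((\<lambda>x. x - p) ` F)"
      using assms(2) dirs_eq_span[OF pF] span_scale by blast
    ultimately show ?thesis by blast
  qed
  ultimately show thesis using that[OF e0] d(2) by blast
qed

text \<open>For \<open>c < y < d\<close> this is the tent function of height 1 with peak at
  \<open>y\<close>, zero outside the interval from \<open>c\<close> to \<open>d\<close>. It confines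
  a perturbation of a section to one cell.\<close>

definition hat :: "real \<Rightarrow> real \<Rightarrow> real \<Rightarrow> real \<Rightarrow> real" where
  "hat c y d t = max 0 (min ((t - c) / (y - c)) ((d - t) / (d - y)))"

lemma continuous_on_hat: "c < y \<Longrightarrow> y < d \<Longrightarrow> continuous_on S (hat c y d)"
  unfolding hat_def by (intro continuous_intros) auto

lemma hat_outside:
  assumes "c < y" "y < d" "t \<le> c \<or> d \<le> t"
  shows "hat c y d t = 0"
proof -
  have "(t - c) / (y - c) \<le> 0 \<or> (d - t) / (d - y) \<le> 0"
    using assms by (auto intro: divide_nonpos_pos)
  then show ?thesis unfolding hat_def by linarith
qed

lemma hat_left:
  assumes "c < y" "y < d" "c \<le> t" "t \<le> y"
  shows "hat c y d t = (t - c) / (y - c)"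
proof -
  have "(t - c) / (y - c) \<le> 1" "1 \<le> (d - t) / (d - y)" "0 \<le> (t - c) / (y - c)"
    using assms by (simp_all add: field_simps)
  then show ?thesis unfolding hat_def by linarith
qed

lemma hat_right:
  assumes "c < y" "y < d" "y \<le> t" "t \<le> d"
  shows "hat c y d t = (d - t) / (d - y)"
proof -
  have "(d - t) / (d - y) \<le> 1" "1 \<le> (t - c) / (y - c)" "0 \<le> (d - t) / (d - y)"
    using assms by (simp_all add: field_simps)
  then show ?thesis unfolding hat_def by linarith
qed

lemma integral_hat_pos:
  assumes "c < y" "y < d" "a \<le> c" "d \<le> b"
  shows "integral {a..b} (hat c y d) > 0"
proof -
  have cont: "continuous_on {a..b} (hat c y d)" using assms continuous_on_hat by blast
  have nn: "hat c y d t \<ge> 0" for t by (simp add: hat_def)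
  have "integral {a..b} (hat c y d) \<noteq> 0"
  proof
    assume "integral {a..b} (hat c y d) = 0"
    then have "\<forall>t\<in>{a..b}. hat c y d t = 0"
      using integral_eq_0_iff[OF cont] nn assms by simp
    then have "hat c y d y = 0" using assms by simp
    then show False using hat_left[of c y d y] assms by simp
  qed
  moreover have "integral {a..b} (hat c y d) \<ge> 0"
    using nn by (intro integral_nonneg integrable_continuous_real cont)
  ultimately show ?thesis by simp
qed

context stratified_polytope
begin

section \<open>Levels of the cells in a string\<close>

lemma l_image:
  assumes "convex S" "a \<in> S" "b \<in> S" "\<And>x. x \<in> S \<Longrightarrow> l a \<le> l x \<and> l x \<le> l b"
  shows "l ` S = {l a..l b}"
proof
  show "l ` S \<subseteq> {l a..l b}" using assms(4) by auto
  have "connected (l ` S)"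
    using assms(1) continuous_on_l convex_connected connected_continuous_image by blast
  then show "{l a..l b} \<subseteq> l ` S"
    using assms(2,3) by (intro connected_contains_Icc) auto
qed

lemma l_image_faces_between: "F \<in> faces_between P l a b \<Longrightarrow> l ` F = {l a..l b}"
  by (rule l_image) (auto simp: faces_between_def face_of_imp_convex)

lemma l_image_Q: "le v w \<Longrightarrow> l ` Q v w = {l v..l w}"
  using l_image[of "Q v w" v w] ends_in_Q l_bounds_Q Q_polytope polytope_imp_convex by blast

lemma faces_between_ends_unique:
  assumes "le a b" "le c d" "F \<in> faces_between P l a b" "F \<in> faces_between P l c d"
  shows "a = c" "b = d"
proof -
  have "{l a..l b} = {l c..l d}" using assms l_image_faces_between by metis
  moreover have "l a \<le> l b" using assms le_imp_l_le by blast
  ultimately have "l a = l c" "l b = l d" by (auto simp: Icc_eq_Icc)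
  moreover have "a \<in> Q c d" "b \<in> Q c d"
    using faces_between_Q[OF assms(4)] assms(3) by (auto simp: faces_between_def)
  ultimately show "a = c" "b = d" using Q_min_unique Q_max_unique assms(2) by blast+
qed

lemma cstring_tail_ge: "cstring u w Fs \<Longrightarrow> F \<in> set Fs \<Longrightarrow> x \<in> F \<Longrightarrow> l u \<le> l x"
proof -
  assume *: "cstring u w Fs" "F \<in> set Fs" "x \<in> F"
  then obtain a b where "le u a" "F \<in> faces_between P l a b" using cstring_member by blast
  then show "l u \<le> l x" using *(3) le_imp_l_le[of u a] by (force simp: faces_between_def)
qed

lemma cstring_subset_Q: "cstring v w Fs \<Longrightarrow> F \<in> set Fs \<Longrightarrow> F \<subseteq> Q v w"
proof -
  assume "cstring v w Fs" "F \<in> set Fs"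
  then obtain a b where "le v a" "le b w" "F \<in> faces_between P l a b" using cstring_member by blast
  then show "F \<subseteq> Q v w" using faces_between_Q[of F a b] Q_mono[of v a b w] by blast
qed

lemma cstring_face: "cstring v w Fs \<Longrightarrow> F \<in> set Fs \<Longrightarrow> F face_of P"
  using cstring_member faces_between_Q by blast

lemma cstring_l_order:
  "cstring v w Fs \<Longrightarrow> F \<in> set Fs \<Longrightarrow> G \<in> set Fs \<Longrightarrow> F \<noteq> G \<Longrightarrow>
    (\<forall>s\<in>l ` F. \<forall>t\<in>l ` G. s \<le> t) \<or> (\<forall>s\<in>l ` F. \<forall>t\<in>l ` G. t \<le> s)"
proof (induction Fs arbitrary: v)
  case (Cons H Fs)
  then obtain u where u: "H \<in> faces_between P l v u" "cstring u w Fs" by auto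
  have low: "t \<le> l u" if "t \<in> l ` H" for t using u(1) that by (auto simp: faces_between_def)
  have high: "l u \<le> t" if "K \<in> set Fs" "t \<in> l ` K" for K t using cstring_tail_ge[OF u(2) that(1)] that(2) by blast
  consider "F \<in> set Fs" "G \<in> set Fs" | "F = H" "G \<in> set Fs" | "F \<in> set Fs" "G = H"
    using Cons.prems by auto
  then show ?case
  proof cases
    case 1
    then show ?thesis using Cons.IH[OF u(2)] Cons.prems(4) by blast
  next
    case 2
    then show ?thesis using low high by (metis order_trans)
  next
    case 3
    then show ?thesis using low high by (metis order_trans)
  qed
qed simp

lemma cstring_cover:
  "cstring v w Fs \<Longrightarrow> v \<noteq> w \<Longrightarrow> t \<in> {l v..l w} \<Longrightarrow> \<exists>F\<in>set Fs. t \<in> l ` F"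
proof (induction Fs arbitrary: v)
  case (Cons H Fs)
  then obtain u where u: "H \<in> faces_between P l v u" "cstring u w Fs" by auto
  show ?case
  proof (cases "t \<le> l u")
    case True
    then have "t \<in> l ` H" using l_image_faces_between[OF u(1)] Cons.prems by simp
    then show ?thesis by auto
  next
    case False
    then show ?thesis using Cons.IH[OF u(2)] Cons.prems by fastforce
  qed
qed simp

lemma cstring_Cons_notin: "cstring v w (F # Fs) \<Longrightarrow> G \<in> set Fs \<Longrightarrow> v \<notin> G"
proof
  assume *: "cstring v w (F # Fs)" "G \<in> set Fs" "v \<in> G"
  then obtain u where u: "le v u" "u \<noteq> v" "cstring u w Fs" by auto
  then show False using cstring_tail_ge[OF u(3) *(2,3)] le_imp_l_less[OF u(1)] by force
qed

lemma cstring_distinct: "cstring v w Fs \<Longrightarrow> distinct Fs"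
proof (induction Fs arbitrary: v)
  case (Cons F Fs)
  then have "v \<in> F" by (auto simp: faces_between_def)
  then have "F \<notin> set Fs" using cstring_Cons_notin[OF Cons.prems] by blast
  then show ?case using Cons by auto
qed simp

text \<open>Only the first cell contains the starting vertex, so the set of cells determines their
  order in the list.\<close>

lemma cstring_eq_of_set_eq:
  "cstring v w Fs \<Longrightarrow> cstring v w Gs \<Longrightarrow> set Fs = set Gs \<Longrightarrow> Fs = Gs"
proof (induction Fs arbitrary: v Gs)
  case (Cons F Fs)
  then obtain G Gs' where Gs: "Gs = G # Gs'" by (cases Gs) auto
  obtain u where u: "le v u" "F \<in> faces_between P l v u" "cstring u w Fs" using Cons.prems(1) by auto
  obtain u' where u': "le v u'" "G \<in> faces_between P l v u'" "cstring u' w Gs'"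
    using Cons.prems(2) Gs by auto
  have "v \<in> F" using u(2) by (simp add: faces_between_def)
  then have "F \<notin> set Gs'" using cstring_Cons_notin Cons.prems(2) Gs by blast
  then have FG: "F = G" using Cons.prems(3) Gs by auto
  then have "u = u'" using faces_between_ends_unique u u' by blast
  moreover have "set Fs = set Gs'"
    using Cons.prems(3) cstring_distinct[OF Cons.prems(1)] cstring_distinct[OF Cons.prems(2)] Gs FG by auto
  ultimately show ?case using Cons.IH[OF u(3)] u'(3) FG Gs by blast
qed simp

lemma finite_cstrings: "finite {Fs. cstring v w Fs}"
proof (rule finite_subset)
  show "{Fs. cstring v w Fs} \<subseteq> {Fs. set Fs \<subseteq> {F. F face_of P} \<and> distinct Fs}"
    using cstring_face cstring_distinct by blast
  show "finite {Fs. set Fs \<subseteq> {F. F face_of P} \<and> distinct Fs}"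
    by (intro finite_subset_distinct finite_polytope_faces polytope_P)
qed

section \<open>Sections, their averages and the cells of the path polytope\<close>

definition seg :: "'a \<Rightarrow> 'a \<Rightarrow> real \<Rightarrow> 'a" where
  "seg a b t = a + ((t - l a) / (l b - l a)) *\<^sub>R (b - a)"

lemma seg_ends: "seg a b (l a) = a" "l a < l b \<Longrightarrow> seg a b (l b) = b"
  by (simp_all add: seg_def)

lemma l_seg: "l a < l b \<Longrightarrow> l (seg a b t) = t"
proof -
  assume lt: "l a < l b"
  have "l (seg a b t) = l a + ((t - l a) / (l b - l a)) * (l b - l a)"
    unfolding seg_def by (simp only: linear_add[OF linear_l] linear_scale[OF linear_l] linear_diff[OF linear_l] real_scaleR_def)
  then show ?thesis using lt by simp
qed

lemma seg_in_convex:
  assumes "convex F" "a \<in> F" "b \<in> F" "l a < l b" "l a \<le> t" "t \<le> l b"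
  shows "seg a b t \<in> F"
proof -
  let ?s = "(t - l a) / (l b - l a)"
  have "0 \<le> ?s" "?s \<le> 1" using assms by (auto simp: field_simps)
  then have "(1 - ?s) *\<^sub>R a + ?s *\<^sub>R b \<in> F" using assms convexD_alt by blast
  moreover have "(1 - ?s) *\<^sub>R a + ?s *\<^sub>R b = seg a b t" by (simp add: seg_def algebra_simps)
  ultimately show ?thesis by simp
qed

lemma continuous_on_seg: "continuous_on S (seg a b)"
  unfolding seg_def divide_inverse by (intro continuous_intros)

text \<open>The polygonal path through the consecutive vertices of the string. Its values are stated
  for all \<open>a\<close> and \<open>b\<close> that fit a cell, since the string does not store its
  vertices.\<close>

lemma spine_exists:
  "cstring v w Fs \<Longrightarrow> \<exists>\<sigma>. continuous_on {l v..l w} \<sigma> \<and> \<sigma> (l v) = v \<and>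
    (\<forall>F\<in>set Fs. \<forall>a b. le a b \<longrightarrow> F \<in> faces_between P l a b \<longrightarrow> (\<forall>t\<in>{l a..l b}. \<sigma> t = seg a b t))"
proof (induction Fs arbitrary: v)
  case Nil
  then show ?case by (intro exI[of _ "\<lambda>t. v"]) simp
next
  case (Cons F Fs)
  then obtain u where u: "le v u" "u \<noteq> v" "F \<in> faces_between P l v u" "cstring u w Fs" by auto
  obtain \<sigma> where \<sigma>: "continuous_on {l u..l w} \<sigma>" "\<sigma> (l u) = u"
    "\<And>G a b t. G \<in> set Fs \<Longrightarrow> le a b \<Longrightarrow> G \<in> faces_between P l a b \<Longrightarrow> t \<in> {l a..l b} \<Longrightarrow> \<sigma> t = seg a b t"
    using Cons.IH[OF u(4)] by blast
  have lt: "l v < l u" using u le_imp_l_less by blast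
  have luw: "l u \<le> l w" using cstring_le[OF u(4)] le_imp_l_le by blast
  define \<tau> where "\<tau> = (\<lambda>t. if t \<le> l u then seg v u t else \<sigma> t)"
  have eq: "\<tau> t = \<sigma> t" if "t \<ge> l u" for t
    using that seg_ends(2)[OF lt] \<sigma>(2) by (auto simp: \<tau>_def)
  have "continuous_on ({l v..l u} \<union> {l u..l w}) \<tau>"
    unfolding \<tau>_def
    by (rule continuous_on_If) (use seg_ends(2)[OF lt] \<sigma> continuous_on_seg in auto)
  moreover have "{l v..l u} \<union> {l u..l w} = {l v..l w}" using lt luw by auto
  moreover have "\<tau> (l v) = v" using lt seg_ends(1) by (simp add: \<tau>_def)
  moreover have "\<tau> t = seg a b t"
    if G: "G \<in> set (F # Fs)" "le a b" "G \<in> faces_between P l a b" "t \<in> {l a..l b}" for G a b t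
  proof (cases "G = F")
    case True
    then have "a = v" "b = u" using faces_between_ends_unique G u by blast+
    then show ?thesis using G(4) by (simp add: \<tau>_def)
  next
    case False
    then have GF: "G \<in> set Fs" using G by simp
    have "a \<in> G" using G(3) by (simp add: faces_between_def)
    then have "t \<ge> l u" using cstring_tail_ge[OF u(4) GF] G(4) by fastforce
    then show ?thesis using eq \<sigma>(3)[OF GF G(2,3,4)] by simp
  qed
  ultimately show ?case by (intro exI[of _ \<tau>]) simp
qed

definition sections :: "'a \<Rightarrow> 'a \<Rightarrow> (real \<Rightarrow> 'a) set" where
  "sections v w = {\<gamma>. continuous_on {l v..l w} \<gamma> \<and> (\<forall>t\<in>{l v..l w}. \<gamma> t \<in> Q v w \<and> l (\<gamma> t) = t)}"

text \<open>At the common level of two consecutive cells the condition applies to both, so such a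
  section passes through the vertex that joins them.\<close>

definition cell_sections :: "'a \<Rightarrow> 'a \<Rightarrow> 'a set list \<Rightarrow> (real \<Rightarrow> 'a) set" where
  "cell_sections v w Fs = {\<gamma>\<in>sections v w. \<forall>F\<in>set Fs. \<forall>t\<in>l ` F. \<gamma> t \<in> F}"

definition avg :: "'a \<Rightarrow> 'a \<Rightarrow> (real \<Rightarrow> 'a) \<Rightarrow> 'a" where
  "avg v w \<gamma> = (1 / (l w - l v)) *\<^sub>R integral {l v..l w} \<gamma>"

definition cell :: "'a \<Rightarrow> 'a \<Rightarrow> 'a set list \<Rightarrow> 'a set" where
  "cell v w Fs = avg v w ` cell_sections v w Fs"

lemma monotone_path_polytope_eq:
  assumes "le v w" "v \<noteq> w"
  shows "monotone_path_polytope l (Q v w) = avg v w ` sections v w"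
proof -
  have lt: "l v < l w" using assms le_imp_l_less by blast
  have "\<not> (\<exists>p. Q v w = {p})" using ends_in_Q[OF assms(1)] assms(2) by auto
  then have "monotone_path_polytope l (Q v w) = {(1 / (b - a)) *\<^sub>R integral {a..b} \<gamma> | a b \<gamma>.
              a < b \<and> l ` Q v w = {a..b} \<and> continuous_on {a..b} \<gamma> \<and>
              (\<forall>t\<in>{a..b}. \<gamma> t \<in> Q v w \<and> l (\<gamma> t) = t)}"
    by (simp add: monotone_path_polytope_def)
  also have "\<dots> = avg v w ` sections v w"
    using lt unfolding l_image_Q[OF assms(1)] avg_def sections_def by (auto simp: Icc_eq_Icc image_def)
  finally show ?thesis .
qed

lemma cell_sectionsI:
  assumes Fs: "cstring v w Fs" "v \<noteq> w" and cont: "continuous_on {l v..l w} \<gamma>"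
    and F: "\<And>F t. F \<in> set Fs \<Longrightarrow> t \<in> l ` F \<Longrightarrow> \<gamma> t \<in> F \<and> l (\<gamma> t) = t"
  shows "\<gamma> \<in> cell_sections v w Fs"
proof -
  have "\<gamma> t \<in> Q v w \<and> l (\<gamma> t) = t" if "t \<in> {l v..l w}" for t
    using cstring_cover[OF Fs that] F cstring_subset_Q[OF Fs(1)] by blast
  then show ?thesis using cont F by (simp add: cell_sections_def sections_def)
qed

text \<open>A hat function bends the polygonal section through the vertices of the string towards a
  given point of one of its cells.\<close>

lemma spine:
  assumes Fs: "cstring v w Fs" "v \<noteq> w"
  shows "\<exists>\<sigma>. \<sigma> \<in> cell_sections v w Fs \<and>
    (\<forall>F\<in>set Fs. \<forall>a b. \<forall>y\<in>F. le a b \<longrightarrow> F \<in> faces_between P l a b \<longrightarrow> l a < l y \<longrightarrow> l y < l b \<longrightarrow>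
      (\<lambda>t. \<sigma> t + hat (l a) (l y) (l b) t *\<^sub>R (y - \<sigma> (l y))) \<in> cell_sections v w Fs)"
proof -
  obtain \<sigma> where \<sigma>: "continuous_on {l v..l w} \<sigma>"
    "\<And>G a b t. G \<in> set Fs \<Longrightarrow> le a b \<Longrightarrow> G \<in> faces_between P l a b \<Longrightarrow> t \<in> {l a..l b} \<Longrightarrow> \<sigma> t = seg a b t"
    using spine_exists[OF Fs(1)] by blast
  have \<sigma>F: "\<sigma> t \<in> F \<and> l (\<sigma> t) = t" if F: "F \<in> set Fs" "t \<in> l ` F" for F t
  proof -
    obtain a b where ab: "le a b" "a \<noteq> b" "F \<in> faces_between P l a b" using cstring_member[OF Fs(1) F(1)] by blast
    have lt: "l a < l b" using ab le_imp_l_less by blast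
    have t: "t \<in> {l a..l b}" using F(2) l_image_faces_between[OF ab(3)] by simp
    have "convex F" "a \<in> F" "b \<in> F" using ab(3) by (auto simp: faces_between_def face_of_imp_convex)
    then show ?thesis using \<sigma>(2)[OF F(1) ab(1,3) t] l_seg[OF lt] seg_in_convex lt t by auto
  qed
  have bent: "(\<lambda>t. \<sigma> t + hat (l a) (l y) (l b) t *\<^sub>R (y - \<sigma> (l y))) \<in> cell_sections v w Fs" (is "?\<gamma> \<in> _")
    if F: "F \<in> set Fs" "le a b" "F \<in> faces_between P l a b" "y \<in> F" "l a < l y" "l y < l b" for F a b y
  proof (rule cell_sectionsI[OF Fs])
    show "continuous_on {l v..l w} ?\<gamma>"
      using F by (intro continuous_intros \<sigma> continuous_on_hat)
    have lF: "l ` F = {l a..l b}" using l_image_faces_between F(3) by blast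
    have cF: "convex F" "a \<in> F" "b \<in> F" using F(3) by (auto simp: faces_between_def face_of_imp_convex)
    have ly: "l (\<sigma> (l y)) = l y" using \<sigma>F F(1,4) by blast
    have lt: "l a < l b" using F by simp
    have sy: "\<sigma> (l y) = seg a b (l y)" using \<sigma>(2)[OF F(1,2,3)] F by simp
    fix G t assume G: "G \<in> set Fs" "t \<in> l ` G"
    have "l (?\<gamma> t) = l (\<sigma> t)" using linear_l ly by (simp add: linear_add linear_scale linear_diff)
    moreover have "?\<gamma> t \<in> G"
    proof (cases "t \<le> l a \<or> l b \<le> t")
      case True
      then show ?thesis using hat_outside[OF F(5,6) True] \<sigma>F G by simp
    next
      case False
      \<comment> \<open>Cells of a string share end levels at most, so a level strictly between
        \<open>l a\<close> and \<open>l b\<close> belongs to \<open>F\<close> alone.\<close>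
      have "G = F"
      proof (rule ccontr)
        assume "G \<noteq> F"
        moreover have "l a \<in> l ` F" "l b \<in> l ` F" using lF lt by auto
        ultimately show False using cstring_l_order[OF Fs(1) G(1) F(1)] G(2) False by force
      qed
      have st: "\<sigma> t = seg a b t" using \<sigma>(2)[OF F(1,2,3)] False by simp
      have n: "l y - l a \<noteq> 0" "l b - l y \<noteq> 0" "l b - l a \<noteq> 0" using F by auto
      have frac: "p / x * (x / q) = p / q" if "x \<noteq> 0" for p x q :: real using that by simp
      \<comment> \<open>Over \<open>F\<close> the bent path is the broken line from \<open>a\<close>
        via \<open>y\<close> to \<open>b\<close>: subtracting the tent times
        \<open>\<sigma> (l y)\<close> and adding the tent times \<open>y\<close> turns one segment
        into two, both inside \<open>F\<close> by convexity.\<close>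
      have "?\<gamma> t \<in> F"
      proof (cases "t \<le> l y")
        case True
        have s: "hat (l a) (l y) (l b) t = (t - l a) / (l y - l a)" (is "_ = ?s")
          using hat_left F False True by simp
        have "0 \<le> ?s" "?s \<le> 1" using F False True by (auto simp: field_simps)
        then have inF: "(1 - ?s) *\<^sub>R a + ?s *\<^sub>R y \<in> F" using cF F(4) convexD_alt by blast
        have c: "?s * ((l y - l a) / (l b - l a)) = (t - l a) / (l b - l a)" using n(1) by (rule frac)
        have "?\<gamma> t = (1 - ?s) *\<^sub>R a + ?s *\<^sub>R y + ((t - l a) / (l b - l a)) *\<^sub>R (b - a)
            - (?s * ((l y - l a) / (l b - l a))) *\<^sub>R (b - a)"
          unfolding s st sy seg_def by (simp add: algebra_simps)
        then have "?\<gamma> t = (1 - ?s) *\<^sub>R a + ?s *\<^sub>R y" unfolding c by simp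
        then show ?thesis using inF by simp
      next
        case False2: False
        have s: "hat (l a) (l y) (l b) t = (l b - t) / (l b - l y)" (is "_ = ?s")
          using hat_right F False False2 by simp
        have "0 \<le> ?s" "?s \<le> 1" using F False False2 by (auto simp: field_simps)
        then have inF: "(1 - ?s) *\<^sub>R b + ?s *\<^sub>R y \<in> F" using cF F(4) convexD_alt by blast
        have seg': "seg a b r = b - ((l b - r) / (l b - l a)) *\<^sub>R (b - a)" for r
        proof -
          have "(r - l a) / (l b - l a) = 1 - (l b - r) / (l b - l a)" using n by (simp add: field_simps)
          then show ?thesis unfolding seg_def by (simp add: scaleR_left_diff_distrib)
        qed
        have c: "?s * ((l b - l y) / (l b - l a)) = (l b - t) / (l b - l a)" using n(2) by (rule frac)
        have "?\<gamma> t = (1 - ?s) *\<^sub>R b + ?s *\<^sub>R y - ((l b - t) / (l b - l a)) *\<^sub>R (b - a)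
            + (?s * ((l b - l y) / (l b - l a))) *\<^sub>R (b - a)"
          unfolding s st sy seg' by (simp add: algebra_simps)
        then have "?\<gamma> t = (1 - ?s) *\<^sub>R b + ?s *\<^sub>R y" unfolding c by simp
        then show ?thesis using inF by simp
      qed
      then show ?thesis using \<open>G = F\<close> by simp
    qed
    ultimately show "?\<gamma> t \<in> G \<and> l (?\<gamma> t) = t" using \<sigma>F[OF G] by simp
  qed
  have "\<sigma> \<in> cell_sections v w Fs" using cell_sectionsI[OF Fs \<sigma>(1)] \<sigma>F by blast
  then show ?thesis using bent by (intro exI[of _ \<sigma>]) simp
qed

lemma cell_sections_nonempty: "cstring v w Fs \<Longrightarrow> v \<noteq> w \<Longrightarrow> cell_sections v w Fs \<noteq> {}"
  using spine[of v w Fs] by fast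

lemma section_integrable: "\<gamma> \<in> sections v w \<Longrightarrow> \<gamma> integrable_on {l v..l w}"
  by (auto simp: sections_def intro: integrable_continuous_real)

lemma linear_avg:
  fixes g :: "'a \<Rightarrow> real"
  assumes "linear g" "\<gamma> \<in> sections v w"
  shows "g (avg v w \<gamma>) = (1 / (l w - l v)) * integral {l v..l w} (\<lambda>t. g (\<gamma> t))"
proof -
  have "integral {l v..l w} (g \<circ> \<gamma>) = g (integral {l v..l w} \<gamma>)"
    using assms(1) linear_conv_bounded_linear by (intro integral_linear section_integrable[OF assms(2)]) auto
  then show ?thesis using assms(1) by (simp add: avg_def linear_scale o_def)
qed

text \<open>At every level a section inside the cells lies on the lower boundary, so the excess of
  \<open>g\<close> along any section over it is nonnegative and continuous. The integral of such a
  function vanishes only if the function does; hence the minimising sections are those that stay in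
  the cells.\<close>

lemma coherent_exposes:
  assumes Fs: "cstring v w Fs" "v \<noteq> w" and g: "linear g" "coherent v w g Fs"
  obtains m where "\<And>\<gamma>. \<gamma> \<in> sections v w \<Longrightarrow> m \<le> g (avg v w \<gamma>)"
    "\<And>\<gamma>. \<gamma> \<in> sections v w \<Longrightarrow> g (avg v w \<gamma>) = m \<longleftrightarrow> \<gamma> \<in> cell_sections v w Fs"
proof -
  have lt: "l v < l w" using cstring_le[OF Fs(1)] Fs(2) le_imp_l_less by blast
  obtain \<sigma> where \<sigma>: "\<sigma> \<in> cell_sections v w Fs" using cell_sections_nonempty[OF Fs] by blast
  then have \<sigma>s: "\<sigma> \<in> sections v w" by (simp add: cell_sections_def)
  have cg: "continuous_on {l v..l w} (\<lambda>t. g (\<gamma> t))" if "\<gamma> \<in> sections v w" for \<gamma>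
    using that g(1) linear_continuous_on_compose unfolding sections_def by blast
  have on_cell: "g (\<sigma> t) \<le> g (\<gamma> t) \<and> (g (\<gamma> t) = g (\<sigma> t) \<longleftrightarrow> \<gamma> t \<in> F)"
    if \<gamma>: "\<gamma> \<in> sections v w" and F: "F \<in> set Fs" "t \<in> l ` F" for \<gamma> F t
  proof -
    have "\<exists>c d. \<forall>x\<in>Q v w. c * l x + d \<le> g x \<and> (g x = c * l x + d \<longleftrightarrow> x \<in> F)"
      using g(2) F(1) unfolding coherent_def by (rule bspec)
    then obtain c d where cd: "\<And>x. x \<in> Q v w \<Longrightarrow> c * l x + d \<le> g x \<and> (g x = c * l x + d \<longleftrightarrow> x \<in> F)"
      by auto
    have t: "t \<in> {l v..l w}" using F cstring_subset_Q[OF Fs(1) F(1)] l_bounds_Q by auto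
    have "\<sigma> t \<in> F" using \<sigma> F by (auto simp: cell_sections_def)
    then show ?thesis using cd[of "\<sigma> t"] cd[of "\<gamma> t"] t \<gamma> \<sigma>s unfolding sections_def by auto
  qed
  have diff: "g (avg v w \<gamma>) - g (avg v w \<sigma>) =
      (1 / (l w - l v)) * integral {l v..l w} (\<lambda>t. g (\<gamma> t) - g (\<sigma> t))" if "\<gamma> \<in> sections v w" for \<gamma>
    using linear_avg[OF g(1) that] linear_avg[OF g(1) \<sigma>s]
      integral_diff[OF integrable_continuous_real[OF cg[OF that]] integrable_continuous_real[OF cg[OF \<sigma>s]]]
    by (simp add: diff_divide_distrib)
  have nn: "g (\<gamma> t) - g (\<sigma> t) \<ge> 0" if "\<gamma> \<in> sections v w" "t \<in> {l v..l w}" for \<gamma> t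
    using cstring_cover[OF Fs that(2)] on_cell[OF that(1)] by auto
  have cd: "continuous_on {l v..l w} (\<lambda>t. g (\<gamma> t) - g (\<sigma> t))" if "\<gamma> \<in> sections v w" for \<gamma>
    using cg that \<sigma>s by (intro continuous_on_diff)
  show thesis
  proof (rule that)
    fix \<gamma> assume \<gamma>: "\<gamma> \<in> sections v w"
    have "integral {l v..l w} (\<lambda>t. g (\<gamma> t) - g (\<sigma> t)) \<ge> 0"
      using nn[OF \<gamma>] by (intro integral_nonneg integrable_continuous_real cd \<gamma>)
    then have "(1 / (l w - l v)) * integral {l v..l w} (\<lambda>t. g (\<gamma> t) - g (\<sigma> t)) \<ge> 0" using lt by simp
    then show "g (avg v w \<sigma>) \<le> g (avg v w \<gamma>)" using diff[OF \<gamma>] by linarith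
    have "g (avg v w \<gamma>) = g (avg v w \<sigma>) \<longleftrightarrow> integral {l v..l w} (\<lambda>t. g (\<gamma> t) - g (\<sigma> t)) = 0"
      using diff[OF \<gamma>] lt by auto
    also have "\<dots> \<longleftrightarrow> (\<forall>t\<in>{l v..l w}. g (\<gamma> t) - g (\<sigma> t) = 0)"
      by (rule integral_eq_0_iff[OF cd[OF \<gamma>] lt nn[OF \<gamma>]])
    also have "\<dots> \<longleftrightarrow> (\<forall>F\<in>set Fs. \<forall>t\<in>l ` F. \<gamma> t \<in> F)"
    proof
      assume *: "\<forall>t\<in>{l v..l w}. g (\<gamma> t) - g (\<sigma> t) = 0"
      show "\<forall>F\<in>set Fs. \<forall>t\<in>l ` F. \<gamma> t \<in> F"
      proof (intro ballI)
        fix F t assume F: "F \<in> set Fs" "t \<in> l ` F"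
        have "t \<in> {l v..l w}" using F cstring_subset_Q[OF Fs(1) F(1)] l_bounds_Q by auto
        then show "\<gamma> t \<in> F" using on_cell[OF \<gamma> F] * by simp
      qed
    next
      assume *: "\<forall>F\<in>set Fs. \<forall>t\<in>l ` F. \<gamma> t \<in> F"
      show "\<forall>t\<in>{l v..l w}. g (\<gamma> t) - g (\<sigma> t) = 0"
        using cstring_cover[OF Fs] on_cell[OF \<gamma>] * by (metis diff_self)
    qed
    also have "\<dots> \<longleftrightarrow> \<gamma> \<in> cell_sections v w Fs" using \<gamma> by (simp add: cell_sections_def)
    finally show "g (avg v w \<gamma>) = g (avg v w \<sigma>) \<longleftrightarrow> \<gamma> \<in> cell_sections v w Fs" .
  qed
qed

end

subsection \<open>Faces of the monotone path polytope\<close>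

lemma sum_num_faces:
  fixes C :: "'a::euclidean_space set" and x :: "'b::comm_semiring_1"
  assumes "polytope C"
  shows "(\<Sum>i=0..nat (aff_dim C). of_nat (num_faces C (int i)) * x ^ i) =
    (\<Sum>F\<in>{F. F face_of C \<and> F \<noteq> {}}. x ^ nat (aff_dim F))"
proof -
  let ?S = "{F. F face_of C \<and> F \<noteq> {}}"
  have fin: "finite ?S" using finite_polytope_faces[OF assms] by simp
  have nn: "0 \<le> aff_dim F" if "F \<in> ?S" for F
    using that aff_dim_negative_iff[of F] by (metis (mono_tags, lifting) linorder_not_less mem_Collect_eq)
  have "(\<Sum>F\<in>?S. x ^ nat (aff_dim F)) =
      (\<Sum>i\<in>{0..nat (aff_dim C)}. \<Sum>F\<in>{F\<in>?S. nat (aff_dim F) = i}. x ^ nat (aff_dim F))"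
    using fin by (intro sum.group[symmetric]) (auto intro!: nat_mono aff_dim_subset face_of_imp_subset)
  also have "\<dots> = (\<Sum>i=0..nat (aff_dim C). of_nat (num_faces C (int i)) * x ^ i)"
  proof (rule sum.cong[OF refl])
    fix i
    have "{F. F face_of C \<and> aff_dim F = int i} = {F\<in>?S. nat (aff_dim F) = i}" using nn by force
    then show "(\<Sum>F\<in>{F\<in>?S. nat (aff_dim F) = i}. x ^ nat (aff_dim F)) =
        of_nat (num_faces C (int i)) * x ^ i"
      by (simp add: num_faces_def)
  qed
  finally show ?thesis by simp
qed

context stratified_polytope
begin

definition path_polytope :: "'a \<Rightarrow> 'a \<Rightarrow> 'a set" where
  "path_polytope v w = avg v w ` sections v w"

lemma convex_path_polytope:
  assumes "le v w"
  shows "convex (path_polytope v w)"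
proof (rule convexI)
  fix x y s t assume xy: "x \<in> path_polytope v w" "y \<in> path_polytope v w"
    and st: "0 \<le> s" "0 \<le> t" "s + t = (1::real)"
  obtain \<gamma> \<gamma>' where g: "\<gamma> \<in> sections v w" "x = avg v w \<gamma>" "\<gamma>' \<in> sections v w" "y = avg v w \<gamma>'"
    using xy by (auto simp: path_polytope_def)
  let ?\<delta> = "\<lambda>r. s *\<^sub>R \<gamma> r + t *\<^sub>R \<gamma>' r"
  have "s *\<^sub>R x + t *\<^sub>R y = avg v w ?\<delta>"
    using g section_integrable[OF g(1)] section_integrable[OF g(3)]
    by (simp add: avg_def integral_add integrable_cmul scaleR_add_right mult.commute)
  moreover have "?\<delta> \<in> sections v w"
  proof -
    have "convex (Q v w)" using assms Q_polytope polytope_imp_convex by blast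
    then have "?\<delta> r \<in> Q v w" if "r \<in> {l v..l w}" for r
      using g that st by (auto simp: sections_def intro: convexD)
    moreover have "l (?\<delta> r) = r" if "r \<in> {l v..l w}" for r
    proof -
      have "l (?\<delta> r) = s * r + t * r"
        using g that linear_l by (simp add: sections_def linear_add linear_scale)
      then show ?thesis using st by (simp flip: distrib_right)
    qed
    ultimately show ?thesis using g by (auto simp: sections_def intro!: continuous_intros)
  qed
  ultimately show "s *\<^sub>R x + t *\<^sub>R y \<in> path_polytope v w" by (auto simp: path_polytope_def)
qed

lemma cell_subset: "cell v w Fs \<subseteq> path_polytope v w"
  by (auto simp: cell_def path_polytope_def cell_sections_def)

text \<open>The clause about sections says more than the one about points: different sections may
  have the same average, yet an average lying in the cell forces its section to run inside the
  string.\<close>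

lemma cell_exposed:
  assumes "cstring v w Fs" "v \<noteq> w" "linear g" "coherent v w g Fs"
  shows "\<exists>m. (\<forall>x\<in>path_polytope v w. m \<le> g x) \<and>
    (\<forall>\<gamma>\<in>sections v w. g (avg v w \<gamma>) = m \<longleftrightarrow> \<gamma> \<in> cell_sections v w Fs) \<and>
    cell v w Fs = {x\<in>path_polytope v w. g x = m}"
proof -
  obtain m where m: "\<And>\<gamma>. \<gamma> \<in> sections v w \<Longrightarrow> m \<le> g (avg v w \<gamma>)"
    "\<And>\<gamma>. \<gamma> \<in> sections v w \<Longrightarrow> g (avg v w \<gamma>) = m \<longleftrightarrow> \<gamma> \<in> cell_sections v w Fs"
    using coherent_exposes[OF assms] by blast
  have "cell v w Fs = {x\<in>path_polytope v w. g x = m}"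
    using m(2) unfolding cell_def path_polytope_def by (auto simp: cell_sections_def)
  then show ?thesis using m unfolding path_polytope_def by (intro exI[of _ m]) simp
qed

lemma cell_nonempty: "cstring v w Fs \<Longrightarrow> v \<noteq> w \<Longrightarrow> cell v w Fs \<noteq> {}"
  unfolding cell_def using cell_sections_nonempty by blast

text \<open>Every linear functional attains its minimum over the path polytope on some cell, so choosing
  one point in each of the finitely many cells gives a set whose convex hull is everything.\<close>

lemma polytope_path_polytope:
  assumes vw: "le v w" "v \<noteq> w"
  shows "polytope (path_polytope v w)"
proof -
  define pt where "pt = (\<lambda>Fs. SOME x. x \<in> cell v w Fs)"
  have pt: "pt Fs \<in> cell v w Fs" if "cstring v w Fs" for Fs
    unfolding pt_def using cell_nonempty[OF that vw(2)] some_in_eq by blast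
  let ?X = "pt ` {Fs. cstring v w Fs}"
  have fin: "finite ?X" using finite_cstrings by blast
  have "?X \<subseteq> path_polytope v w" using pt cell_subset by blast
  then have "convex hull ?X \<subseteq> path_polytope v w"
    using convex_path_polytope[OF vw(1)] by (rule hull_minimal)
  moreover have "path_polytope v w \<subseteq> convex hull ?X"
  proof
    fix x assume x: "x \<in> path_polytope v w"
    show "x \<in> convex hull ?X"
    proof (rule ccontr)
      assume "x \<notin> convex hull ?X"
      then obtain a b where ab: "a \<bullet> x < b" "\<And>y. y \<in> convex hull ?X \<Longrightarrow> b < a \<bullet> y"
        using separating_hyperplane_closed_point[of "convex hull ?X" x] fin
        by (metis convex_convex_hull compact_imp_closed finite_imp_compact_convex_hull)
      have lin: "linear (\<lambda>y. a \<bullet> y)" by (intro bounded_linear.linear bounded_linear_inner_right)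
      obtain Fs where Fs: "cstring v w Fs" "coherent v w (\<lambda>y. a \<bullet> y) Fs"
        using lower_boundary[OF vw(1) lin] by blast
      obtain m where m: "\<forall>x\<in>path_polytope v w. m \<le> a \<bullet> x"
        "\<forall>\<gamma>\<in>sections v w. a \<bullet> avg v w \<gamma> = m \<longleftrightarrow> \<gamma> \<in> cell_sections v w Fs"
        "cell v w Fs = {x\<in>path_polytope v w. a \<bullet> x = m}"
        using cell_exposed[OF Fs(1) vw(2) lin Fs(2)] by (elim exE conjE) (rule that)
      have "pt Fs \<in> convex hull ?X" using Fs(1) by (intro hull_inc) blast
      then have "b < a \<bullet> pt Fs" using ab(2) by blast
      moreover have "a \<bullet> pt Fs = m" using pt[OF Fs(1)] m(3) by blast
      moreover have "m \<le> a \<bullet> x" using m(1) x by blast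
      ultimately show False using ab(1) by linarith
    qed
  qed
  ultimately show ?thesis unfolding polytope_def using fin by blast
qed

lemma cell_face:
  assumes "le v w" "v \<noteq> w" "cstring v w Fs"
  shows "cell v w Fs face_of path_polytope v w"
proof -
  obtain g where g: "linear g" "coherent v w g Fs" using coherent_exists assms by blast
  obtain m where "\<forall>x\<in>path_polytope v w. m \<le> g x"
    "\<forall>\<gamma>\<in>sections v w. g (avg v w \<gamma>) = m \<longleftrightarrow> \<gamma> \<in> cell_sections v w Fs"
    "cell v w Fs = {x\<in>path_polytope v w. g x = m}"
    using cell_exposed[OF assms(3,2) g] by (elim exE conjE) (rule that)
  then show ?thesis using linear_minimum_face[OF g(1) convex_path_polytope[OF assms(1)]] by simp
qed

text \<open>A functional exposing \<open>T\<close> has a string as its lower boundary, and the cell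
  of that string is its set of minimisers as well.\<close>

lemma face_is_cell:
  assumes vw: "le v w" "v \<noteq> w" and T: "T face_of path_polytope v w" "T \<noteq> {}"
  obtains Fs where "cstring v w Fs" "T = cell v w Fs"
proof -
  obtain g :: "'a \<Rightarrow> real" and k where g: "linear g" "\<And>x. x \<in> path_polytope v w \<Longrightarrow> k \<le> g x"
    "\<And>x. x \<in> path_polytope v w \<Longrightarrow> g x = k \<longleftrightarrow> x \<in> T"
    using exposing_functional[OF polytope_path_polytope[OF vw] T] by blast
  obtain Fs where Fs: "cstring v w Fs" "coherent v w g Fs"
    using lower_boundary[OF vw(1) g(1)] by blast
  obtain m where m: "\<forall>x\<in>path_polytope v w. m \<le> g x"
    "\<forall>\<gamma>\<in>sections v w. g (avg v w \<gamma>) = m \<longleftrightarrow> \<gamma> \<in> cell_sections v w Fs"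
    "cell v w Fs = {x\<in>path_polytope v w. g x = m}"
    using cell_exposed[OF Fs(1) vw(2) g(1) Fs(2)] by (elim exE conjE) (rule that)
  have sub: "T \<subseteq> path_polytope v w" using T(1) face_of_imp_subset by blast
  obtain y where y: "y \<in> T" using T(2) by blast
  obtain z where z: "z \<in> cell v w Fs" using cell_nonempty[OF Fs(1) vw(2)] by blast
  have "g y = k" "y \<in> path_polytope v w" using y sub g(3) by blast+
  moreover have "g z = m" "z \<in> path_polytope v w" using z m(3) by blast+
  ultimately have "k = m" using m(1) g(2) by force
  then have "T = cell v w Fs" using m(3) g(3) sub by blast
  then show thesis using that Fs(1) by blast
qed

lemma rel_interior_strictly_between:
  assumes ab: "le a b" "a \<noteq> b" and F: "F \<in> faces_between P l a b" and p: "p \<in> rel_interior F"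
  shows "l a < l p" "l p < l b"
proof -
  have FQ: "F \<subseteq> Q a b" and FP: "F face_of P" using faces_between_Q[OF F] by blast+
  have abF: "a \<in> F" "b \<in> F" using F by (auto simp: faces_between_def)
  have pF: "p \<in> F" using p rel_interior_subset by blast
  have ext: "x extreme_point_of F" if "x = a \<or> x = b" for x
    using that abF FP le_vertex ab(1) extreme_point_of_face by blast
  have np: "p \<noteq> x" if "x = a \<or> x = b" for x
    using extreme_point_not_in_REL_INTERIOR[OF ext[OF that]] p abF ab(2) that by blast
  show "l a < l p" using l_bounds_Q(1)[of p a b] Q_min_unique[OF ab(1), of p] FQ pF np by force
  show "l p < l b" using l_bounds_Q(2)[of p a b] Q_max_unique[OF ab(1), of p] FQ pF np by force
qed

lemma rel_interior_nonempty: "F \<in> faces_between P l a b \<Longrightarrow> rel_interior F \<noteq> {}"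
  using rel_interior_eq_empty[of F] face_of_imp_convex by (auto simp: faces_between_def)

text \<open>A relative interior point lies strictly between the end levels of its cell, so the
  polygonal section can be bent towards it. The tent has height 1 at its peak, so the bent section
  goes through \<open>p\<close>.\<close>

lemma cell_sections_through:
  assumes Fs: "cstring v w Fs" "v \<noteq> w" and F: "F \<in> set Fs" "p \<in> rel_interior F"
  obtains \<gamma> where "\<gamma> \<in> cell_sections v w Fs" "\<gamma> (l p) = p"
proof -
  obtain a b where ab: "le a b" "a \<noteq> b" "F \<in> faces_between P l a b"
    using cstring_member[OF Fs(1) F(1)] by blast
  note lt = rel_interior_strictly_between[OF ab F(2)]
  have pF: "p \<in> F" using F(2) rel_interior_subset by blast
  obtain \<sigma> where bent: "\<forall>F\<in>set Fs. \<forall>a b. \<forall>y\<in>F. le a b \<longrightarrow> F \<in> faces_between P l a b \<longrightarrow>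
      l a < l y \<longrightarrow> l y < l b \<longrightarrow>
      (\<lambda>t. \<sigma> t + hat (l a) (l y) (l b) t *\<^sub>R (y - \<sigma> (l y))) \<in> cell_sections v w Fs"
    using spine[OF Fs] by (elim exE conjE) (rule that)
  have "(\<lambda>t. \<sigma> t + hat (l a) (l p) (l b) t *\<^sub>R (p - \<sigma> (l p))) \<in> cell_sections v w Fs"
    using bent[rule_format, OF F(1) pF ab(1,3) lt] .
  moreover have "hat (l a) (l p) (l b) (l p) = 1" using hat_left[of "l a" "l p" "l b" "l p"] lt by simp
  ultimately show thesis using that by force
qed

text \<open>A section of \<open>Gs\<close> through a relative interior point \<open>p\<close> of
  \<open>G\<close> must also run inside \<open>Fs\<close>. So a face of \<open>Fs\<close> at the
  level of \<open>p\<close> contains \<open>p\<close>, and a face meeting the relative interior of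
  \<open>G\<close> contains \<open>G\<close>.\<close>

lemma cell_subset_imp:
  assumes vw: "v \<noteq> w" and Fs: "cstring v w Fs" and Gs: "cstring v w Gs"
    and sub: "cell v w Gs \<subseteq> cell v w Fs" and G: "G \<in> set Gs"
  shows "\<exists>F\<in>set Fs. G \<subseteq> F"
proof -
  obtain g where g: "linear g" "coherent v w g Fs" using coherent_exists Fs by blast
  obtain m where "\<forall>x\<in>path_polytope v w. m \<le> g x" and
    m: "\<forall>\<gamma>\<in>sections v w. g (avg v w \<gamma>) = m \<longleftrightarrow> \<gamma> \<in> cell_sections v w Fs"
    "cell v w Fs = {x\<in>path_polytope v w. g x = m}"
    using cell_exposed[OF Fs vw g] by (elim exE conjE) (rule that)
  obtain a b where ab: "le a b" "a \<noteq> b" "G \<in> faces_between P l a b" using cstring_member[OF Gs G] by blast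
  obtain p where p: "p \<in> rel_interior G" using rel_interior_nonempty ab(3) by blast
  obtain \<gamma> where \<gamma>: "\<gamma> \<in> cell_sections v w Gs" "\<gamma> (l p) = p"
    using cell_sections_through[OF Gs vw G p] by blast
  have "avg v w \<gamma> \<in> cell v w Fs" using \<gamma>(1) sub by (auto simp: cell_def)
  then have "\<gamma> \<in> cell_sections v w Fs"
    using m \<gamma>(1) by (simp add: cell_sections_def)
  have "p \<in> G" using p rel_interior_subset by blast
  then have "l p \<in> {l v..l w}" using cstring_subset_Q[OF Gs G] l_bounds_Q by auto
  then obtain F where F: "F \<in> set Fs" "l p \<in> l ` F" using cstring_cover[OF Fs vw] by blast
  then have "p \<in> F" using \<open>\<gamma> \<in> cell_sections v w Fs\<close> \<gamma>(2) by (force simp: cell_sections_def)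
  then have "G \<subseteq> F"
    using subset_of_face_of[OF cstring_face[OF Fs F(1)], of G] cstring_face[OF Gs G] face_of_imp_subset p by blast
  then show ?thesis using F(1) by blast
qed

lemma cstring_antichain:
  assumes Fs: "cstring v w Fs" and F: "F \<in> set Fs" "G \<in> set Fs" "F \<subseteq> G"
  shows "F = G"
proof (rule ccontr)
  assume "F \<noteq> G"
  obtain a b where ab: "le a b" "a \<noteq> b" "F \<in> faces_between P l a b" using cstring_member[OF Fs F(1)] by blast
  have "l a \<in> l ` F" "l b \<in> l ` F" using ab(3) by (auto simp: faces_between_def)
  moreover from this have "l a \<in> l ` G" "l b \<in> l ` G" using F(3) by blast+
  ultimately have "l b \<le> l a" using cstring_l_order[OF Fs F(1,2) \<open>F \<noteq> G\<close>] by blast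
  then show False using le_imp_l_less[OF ab(1,2)] by simp
qed

text \<open>Equal cells make the two strings refine each other. A face \<open>H\<close> lies in some
  \<open>K\<close>, which lies in some \<open>H'\<close> of the first string; as no face of a string
  contains another, all three coincide.\<close>

lemma cell_inj:
  assumes vw: "v \<noteq> w" and Fs: "cstring v w Fs" and Gs: "cstring v w Gs"
    and eq: "cell v w Fs = cell v w Gs"
  shows "Fs = Gs"
proof -
  have sub: "set Hs \<subseteq> set Ks"
    if str: "cstring v w Hs" "cstring v w Ks" "cell v w Hs = cell v w Ks" for Hs Ks
  proof
    fix H assume H: "H \<in> set Hs"
    obtain K where K: "K \<in> set Ks" "H \<subseteq> K"
      using cell_subset_imp[OF vw str(2,1) _ H] str(3) by blast
    obtain H' where H': "H' \<in> set Hs" "K \<subseteq> H'"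
      using cell_subset_imp[OF vw str(1,2) _ K(1)] str(3) by blast
    have "H = H'" using cstring_antichain[OF str(1) H H'(1)] K H' by blast
    then show "H \<in> set Ks" using K H' by (metis subset_antisym)
  qed
  show ?thesis using cstring_eq_of_set_eq[OF Fs Gs] sub[OF Fs Gs eq] sub[OF Gs Fs] eq by blast
qed

section \<open>Dimension of a cell\<close>

definition level_dirs :: "'a set \<Rightarrow> 'a set" where
  "level_dirs F = dirs F \<inter> {z. l z = 0}"

lemma subspace_level_dirs [simp]: "subspace (level_dirs F)"
  unfolding level_dirs_def
  by (intro subspace_inter subspace_dirs) (use linear_l in \<open>auto simp: subspace_def linear_0 linear_add linear_scale\<close>)

text \<open>Since \<open>l\<close> does not vanish on \<open>b - a\<close>, this direction
  complements the level directions. Sections can differ only within a level, which is where the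
  exponents lose 1 per cell.\<close>

lemma dim_level_dirs:
  assumes "le a b" "a \<noteq> b" "F \<in> faces_between P l a b"
  shows "dim (level_dirs F) + 1 = dim (dirs F)"
proof -
  let ?z = "b - a"
  have z: "?z \<in> dirs F" using assms(3) by (intro diff_in_dirs) (auto simp: faces_between_def)
  have lz: "l ?z \<noteq> 0" using le_imp_l_less[OF assms(1,2)] linear_l by (simp add: linear_diff)
  have nz: "?z \<notin> span (level_dirs F)"
    using lz by (subst span_eq_iff[THEN iffD2]) (auto simp: level_dirs_def intro!: subspace_level_dirs[unfolded level_dirs_def])
  have "dirs F = span (insert ?z (level_dirs F))"
  proof
    show "span (insert ?z (level_dirs F)) \<subseteq> dirs F"
      using z by (intro span_minimal) (auto simp: level_dirs_def)
    show "dirs F \<subseteq> span (insert ?z (level_dirs F))"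
    proof
      fix x assume x: "x \<in> dirs F"
      let ?c = "l x / l ?z"
      have "x - ?c *\<^sub>R ?z \<in> dirs F"
        by (rule subspace_diff[OF subspace_dirs x subspace_scale[OF subspace_dirs z]])
      moreover have "l (x - ?c *\<^sub>R ?z) = l x - ?c * l ?z"
        by (simp only: linear_diff[OF linear_l] linear_scale[OF linear_l] real_scaleR_def)
      ultimately have "x - ?c *\<^sub>R ?z \<in> level_dirs F" using lz by (simp add: level_dirs_def)
      then show "x \<in> span (insert ?z (level_dirs F))"
        using span_breakdown_eq span_base by blast
    qed
  qed
  then have "dim (dirs F) = dim (insert ?z (level_dirs F))" by simp
  also have "\<dots> = dim (level_dirs F) + 1" using nz by (simp add: dim_insert)
  finally show ?thesis by simp
qed

definition string_dirs :: "'a set list \<Rightarrow> 'a set" where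
  "string_dirs Fs = span (\<Union>F\<in>set Fs. level_dirs F)"

text \<open>Cells of a string join distinct vertices and so have dimension at least 1, which makes
  the truncated subtraction exact.\<close>

definition string_dim :: "'a set list \<Rightarrow> nat" where
  "string_dim Fs = (\<Sum>F\<leftarrow>Fs. nat (aff_dim F) - 1)"

lemma string_dirs_subset:
  assumes "cstring v w Fs"
  shows "string_dirs Fs \<subseteq> dirs (Q v w)"
proof -
  have "level_dirs F \<subseteq> dirs (Q v w)" if "F \<in> set Fs" for F
    using dirs_mono[OF cstring_subset_Q[OF assms that]] by (auto simp: level_dirs_def)
  then show ?thesis unfolding string_dirs_def by (intro span_minimal) auto
qed

text \<open>Level directions of the first cell lie in \<open>dirs (Q v u)\<close>, those of the
  others in \<open>dirs (Q u w)\<close>. These spaces meet only in 0, so the dimensions add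
  up.\<close>

lemma dim_string_dirs: "cstring v w Fs \<Longrightarrow> dim (string_dirs Fs) = string_dim Fs"
proof (induction Fs arbitrary: v)
  case Nil
  then show ?case by (simp add: string_dirs_def string_dim_def)
next
  case (Cons F Fs)
  then obtain u where u: "le v u" "u \<noteq> v" "F \<in> faces_between P l v u" "cstring u w Fs" by auto
  have "level_dirs F \<subseteq> dirs (Q v u)" using faces_between_Q[OF u(3)] dirs_mono by (auto simp: level_dirs_def)
  then have "level_dirs F \<inter> string_dirs Fs \<subseteq> {0}"
    using string_dirs_subset[OF u(4)] dirs_Q_Int[OF u(1) cstring_le[OF u(4)]] by blast
  then have 0: "dim (level_dirs F \<inter> string_dirs Fs) = 0" by (simp only: dim_eq_0)
  have span_F: "span (level_dirs F) = level_dirs F" by (simp add: span_eq_iff)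
  have "string_dirs (F # Fs) = {x + y |x y. x \<in> level_dirs F \<and> y \<in> string_dirs Fs}"
    unfolding string_dirs_def list.set UN_insert span_Un span_F ..
  moreover have "dim {x + y |x y. x \<in> level_dirs F \<and> y \<in> string_dirs Fs} +
      dim (level_dirs F \<inter> string_dirs Fs) = dim (level_dirs F) + dim (string_dirs Fs)"
    by (rule dim_sums_Int) (auto simp: string_dirs_def)
  moreover have "F \<noteq> {}" using u(3) by (auto simp: faces_between_def)
  then have "dim (level_dirs F) = nat (aff_dim F) - 1"
    using dim_level_dirs[OF u(1) u(2)[symmetric] u(3)] by (simp add: aff_dim_dirs)
  ultimately show ?case using 0 Cons.IH[OF u(4)] by (simp add: string_dim_def)
qed

text \<open>A difference of averages is an average of differences, and at each level these are level
  directions of a cell. Conversely a level direction \<open>z\<close> of \<open>F\<close> is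
  realised by bending the polygonal section towards \<open>p\<close> and towards
  \<open>p + e *\<^sub>R z\<close>, for a relative interior point \<open>p\<close>.\<close>

lemma dirs_cell:
  assumes Fs: "cstring v w Fs" and vw: "v \<noteq> w"
  shows "dirs (cell v w Fs) = string_dirs Fs"
proof
  have lt: "l v < l w" using cstring_le[OF Fs] vw le_imp_l_less by blast
  have avg_diff: "avg v w \<gamma> - avg v w \<gamma>' = (1 / (l w - l v)) *\<^sub>R integral {l v..l w} (\<lambda>t. \<gamma> t - \<gamma>' t)"
    if "\<gamma> \<in> cell_sections v w Fs" "\<gamma>' \<in> cell_sections v w Fs" for \<gamma> \<gamma>'
    using that section_integrable by (simp add: avg_def integral_diff cell_sections_def scaleR_diff_right)
  have "x - y \<in> string_dirs Fs" if "x \<in> cell v w Fs" "y \<in> cell v w Fs" for x y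
  proof -
    obtain \<gamma> \<gamma>' where g: "\<gamma> \<in> cell_sections v w Fs" "\<gamma>' \<in> cell_sections v w Fs" "x = avg v w \<gamma>" "y = avg v w \<gamma>'"
      using \<open>x \<in> _\<close> \<open>y \<in> _\<close> unfolding cell_def by blast
    have "integral {l v..l w} (\<lambda>t. \<gamma> t - \<gamma>' t) \<in> string_dirs Fs"
    proof (rule integral_in_subspace)
      show "subspace (string_dirs Fs)" by (simp add: string_dirs_def)
      show "continuous_on {l v..l w} (\<lambda>t. \<gamma> t - \<gamma>' t)"
        using g by (intro continuous_on_diff) (auto simp: cell_sections_def sections_def)
      fix t assume t: "t \<in> {l v..l w}"
      obtain F where F: "F \<in> set Fs" "t \<in> l ` F" using cstring_cover[OF Fs vw t] by blast
      have "\<gamma> t \<in> F" "\<gamma>' t \<in> F" using g F by (auto simp: cell_sections_def)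
      moreover have "l (\<gamma> t - \<gamma>' t) = 0"
        using g(1,2) t linear_l by (auto simp: cell_sections_def sections_def linear_diff)
      ultimately have "\<gamma> t - \<gamma>' t \<in> level_dirs F" by (simp add: level_dirs_def diff_in_dirs)
      then show "\<gamma> t - \<gamma>' t \<in> string_dirs Fs"
        unfolding string_dirs_def using F(1) by (intro span_base) blast
    qed
    then show ?thesis using avg_diff[OF g(1,2)] g(3,4) by (simp add: string_dirs_def span_scale)
  qed
  then show "dirs (cell v w Fs) \<subseteq> string_dirs Fs"
    unfolding dirs_def[of "cell v w Fs"] by (intro span_minimal) (auto simp: string_dirs_def)
  have "z \<in> dirs (cell v w Fs)" if F: "F \<in> set Fs" and z: "z \<in> level_dirs F" for F z
  proof -
    obtain a b where ab: "le v a" "le a b" "a \<noteq> b" "le b w" "F \<in> faces_between P l a b"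
      using cstring_member[OF Fs F] by blast
    obtain p where p: "p \<in> rel_interior F" using rel_interior_nonempty ab(5) by blast
    note lp = rel_interior_strictly_between[OF ab(2,3,5) p]
    have pF: "p \<in> F" using p rel_interior_subset by blast
    obtain e where e: "e > 0" "p + e *\<^sub>R z \<in> F" using rel_interior_move[OF p] z by (auto simp: level_dirs_def)
    have le: "l (p + e *\<^sub>R z) = l p" using z linear_l by (simp add: level_dirs_def linear_add linear_scale)
    let ?h = "hat (l a) (l p) (l b)"
    obtain \<sigma> where bent: "\<forall>F\<in>set Fs. \<forall>a b. \<forall>y\<in>F. le a b \<longrightarrow> F \<in> faces_between P l a b \<longrightarrow>
        l a < l y \<longrightarrow> l y < l b \<longrightarrow>
        (\<lambda>t. \<sigma> t + hat (l a) (l y) (l b) t *\<^sub>R (y - \<sigma> (l y))) \<in> cell_sections v w Fs"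
      using spine[OF Fs vw] by (elim exE conjE) (rule that)
    have \<sigma>: "(\<lambda>t. \<sigma> t + ?h t *\<^sub>R (y - \<sigma> (l p))) \<in> cell_sections v w Fs" if "y \<in> F" "l y = l p" for y
      using bent[rule_format, OF F that(1) ab(2,5)] lp that(2) by simp
    let ?\<gamma> = "\<lambda>y t. \<sigma> t + ?h t *\<^sub>R (y - \<sigma> (l p))"
    have s: "?\<gamma> (p + e *\<^sub>R z) \<in> cell_sections v w Fs" "?\<gamma> p \<in> cell_sections v w Fs"
      using \<sigma>[OF e(2) le] \<sigma>[OF pF refl] by auto
    let ?I = "integral {l v..l w} ?h"
    \<comment> \<open>The two bent sections differ by the tent times \<open>e *\<^sub>R z\<close>,
      so their averages differ by \<open>c *\<^sub>R z\<close>. The tent has positive integral,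
      hence \<open>c\<close> can be divided out.\<close>
    define c where "c = (1 / (l w - l v)) * ?I * e"
    have Ipos: "?I > 0"
      using lp le_imp_l_le[OF ab(1)] le_imp_l_le[OF ab(4)] by (intro integral_hat_pos)
    have hint: "?h integrable_on {l v..l w}"
      using lp by (intro integrable_continuous_real continuous_on_hat)
    have "avg v w (?\<gamma> (p + e *\<^sub>R z)) - avg v w (?\<gamma> p) = (1 / (l w - l v)) *\<^sub>R integral {l v..l w} (\<lambda>t. ?h t *\<^sub>R (e *\<^sub>R z))"
      unfolding avg_diff[OF s] by (simp add: algebra_simps)
    also have "integral {l v..l w} (\<lambda>t. ?h t *\<^sub>R (e *\<^sub>R z)) = ?I *\<^sub>R (e *\<^sub>R z)"
      using integral_linear[OF hint bounded_linear_scaleR_left[of "e *\<^sub>R z"]] by (simp add: o_def)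
    finally have eq: "avg v w (?\<gamma> (p + e *\<^sub>R z)) - avg v w (?\<gamma> p) = c *\<^sub>R z" (is "?d = _")
      by (simp add: c_def)
    have "?d \<in> dirs (cell v w Fs)" using s by (intro diff_in_dirs) (auto simp: cell_def)
    then have "inverse c *\<^sub>R (c *\<^sub>R z) \<in> dirs (cell v w Fs)" unfolding eq by (rule subspace_scale[OF subspace_dirs])
    moreover have "c \<noteq> 0" using lt Ipos e(1) by (simp add: c_def)
    then have "inverse c *\<^sub>R (c *\<^sub>R z) = z" by simp
    ultimately show ?thesis by simp
  qed
  then show "string_dirs Fs \<subseteq> dirs (cell v w Fs)"
    unfolding string_dirs_def by (intro span_minimal) auto
qed

lemma aff_dim_cell: "cstring v w Fs \<Longrightarrow> v \<noteq> w \<Longrightarrow> aff_dim (cell v w Fs) = int (string_dim Fs)"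
  by (simp add: aff_dim_dirs cell_nonempty dirs_cell dim_string_dirs)

lemma cstring_self: "cstring v v Fs \<longleftrightarrow> Fs = [] \<and> v extreme_point_of P"
proof (cases Fs)
  case (Cons F Fs')
  have "\<not> cstring v v (F # Fs')"
  proof
    assume "cstring v v (F # Fs')"
    then obtain u where "le v u" "u \<noteq> v" "cstring u v Fs'" by auto
    then show False using cstring_le[of u v] le_imp_l_less[of v u] le_imp_l_le[of u v] by force
  qed
  then show ?thesis using Cons by simp
qed simp

lemma polytope_monotone_path_polytope: "le v w \<Longrightarrow> polytope (monotone_path_polytope l (Q v w))"
proof (cases "v = w")
  case True
  assume "le v w"
  then have "Q v w = {v}" using True Q_self le_vertex by blast
  then show ?thesis by (simp add: monotone_path_polytope_def polytope_sing)
next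
  case False
  assume "le v w"
  then show ?thesis
    using False monotone_path_polytope_eq polytope_path_polytope by (simp add: path_polytope_def)
qed

lemma monotone_path_polytope_nonempty: "le v w \<Longrightarrow> monotone_path_polytope l (Q v w) \<noteq> {}"
proof (cases "v = w")
  case True
  assume "le v w"
  then have "Q v w = {v}" using True Q_self le_vertex by blast
  then show ?thesis by (simp add: monotone_path_polytope_def)
next
  case False
  assume vw: "le v w"
  obtain Fs where "cstring v w Fs" using lower_boundary[OF vw linear_l] by blast
  then have "path_polytope v w \<noteq> {}" using cell_nonempty[OF _ False] cell_subset by blast
  then show ?thesis using False vw monotone_path_polytope_eq by (simp add: path_polytope_def)
qed

lemma face_sum_monotone_path_polytope:
  fixes x :: "'c::comm_semiring_1"
  assumes vw: "le v w" defines "C \<equiv> monotone_path_polytope l (Q v w)"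
  shows "(\<Sum>i=0..nat (aff_dim C). of_nat (num_faces C (int i)) * x ^ i) =
    (\<Sum>Fs\<in>{Fs. cstring v w Fs}. x ^ string_dim Fs)"
proof (cases "v = w")
  \<comment> \<open>Here the path polytope is a point. Its one nonempty face corresponds to the
    empty string, of dimension 0.\<close>
  case True
  have v: "v extreme_point_of P" using vw le_vertex by blast
  then have "C = {v}" unfolding C_def using True Q_self by (simp add: monotone_path_polytope_def)
  then have "{F. F face_of C \<and> F \<noteq> {}} = {{v}}"
    using face_of_imp_subset[of _ "{v}"] face_of_refl[of "{v}"] by (auto simp: subset_singleton_iff)
  moreover have "{Fs. cstring v w Fs} = {[]}" using True cstring_self v by auto
  moreover have "polytope C" unfolding C_def using polytope_monotone_path_polytope vw by blast
  ultimately show ?thesis by (subst sum_num_faces) (simp_all add: string_dim_def)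
next
  case False
  have C: "C = path_polytope v w"
    unfolding C_def path_polytope_def using monotone_path_polytope_eq vw False by blast
  have "(\<Sum>i=0..nat (aff_dim C). of_nat (num_faces C (int i)) * x ^ i) =
      (\<Sum>F\<in>{F. F face_of C \<and> F \<noteq> {}}. x ^ nat (aff_dim F))"
    unfolding C using polytope_path_polytope[OF vw False] by (rule sum_num_faces)
  also have "{F. F face_of C \<and> F \<noteq> {}} = cell v w ` {Fs. cstring v w Fs}"
    using cell_face[OF vw False] cell_nonempty[OF _ False] face_is_cell[OF vw False] unfolding C by blast
  also have "(\<Sum>F\<in>cell v w ` {Fs. cstring v w Fs}. x ^ nat (aff_dim F)) =
      (\<Sum>Fs\<in>{Fs. cstring v w Fs}. x ^ nat (aff_dim (cell v w Fs)))"
    using cell_inj[OF False] by (subst sum.reindex) (auto simp: inj_on_def)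
  also have "\<dots> = (\<Sum>Fs\<in>{Fs. cstring v w Fs}. x ^ string_dim Fs)"
    using aff_dim_cell False by (intro sum.cong) auto
  finally show ?thesis .
qed

end

subsection \<open>Inverses in the incidence algebra\<close>

text \<open>Reflexivity is required only of elements comparable to something, because
  \<open>vertex_le\<close> relates vertices only and fails at all other points of the type.\<close>

locale incidence_order =
  fixes le :: "'v \<Rightarrow> 'v \<Rightarrow> bool"
  assumes le_refl_left: "le v w \<Longrightarrow> le v v"
    and le_refl_right: "le v w \<Longrightarrow> le w w"
    and le_transitive: "le u v \<Longrightarrow> le v w \<Longrightarrow> le u w"
    and le_antisymmetric: "le v w \<Longrightarrow> le w v \<Longrightarrow> v = w"
    and finite_interval: "finite {u. le v u \<and> le u w}"
begin

text \<open>Both sides become double sums over the whole interval, with comparability of the two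
  inner points as a condition on the summand, so that the order of summation can be
  exchanged.\<close>

lemma inc_mult_assoc: "inc_mult le (inc_mult le a b) c = inc_mult le a (inc_mult le b c)"
proof (intro ext)
  fix v w
  show "inc_mult le (inc_mult le a b) c v w = inc_mult le a (inc_mult le b c) v w"
  proof (cases "le v w")
    case False
    then show ?thesis by (simp add: inc_mult_def)
  next
    case True
    let ?I = "{u. le v u \<and> le u w}"
    have L: "inc_mult le a b v u * c u w = (\<Sum>t\<in>?I. if le t u then a v t * b t u * c u w else 0)"
      if "u \<in> ?I" for u
    proof -
      have eq: "{t. le v t \<and> le t u} = {t\<in>?I. le t u}" using that le_transitive by blast
      have "inc_mult le a b v u * c u w = (\<Sum>t\<in>{t. le v t \<and> le t u}. a v t * b t u * c u w)"
        using that by (simp add: inc_mult_def sum_distrib_right)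
      then show ?thesis unfolding eq sum.inter_filter[OF finite_interval] .
    qed
    have R: "a v t * inc_mult le b c t w = (\<Sum>u\<in>?I. if le t u then a v t * b t u * c u w else 0)"
      if "t \<in> ?I" for t
    proof -
      have eq: "{u. le t u \<and> le u w} = {u\<in>?I. le t u}" using that le_transitive by blast
      have "a v t * inc_mult le b c t w = (\<Sum>u\<in>{u. le t u \<and> le u w}. a v t * b t u * c u w)"
        using that by (simp add: inc_mult_def sum_distrib_left mult.assoc)
      then show ?thesis unfolding eq sum.inter_filter[OF finite_interval] .
    qed
    have "inc_mult le (inc_mult le a b) c v w =
        (\<Sum>u\<in>?I. \<Sum>t\<in>?I. if le t u then a v t * b t u * c u w else 0)"
      using True L by (simp add: inc_mult_def[of le "inc_mult le a b"])
    also have "\<dots> = (\<Sum>t\<in>?I. \<Sum>u\<in>?I. if le t u then a v t * b t u * c u w else 0)"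
      by (rule sum.swap)
    also have "\<dots> = inc_mult le a (inc_mult le b c) v w"
      using True R by (simp add: inc_mult_def[of le a "inc_mult le b c"])
    finally show ?thesis .
  qed
qed

lemma inc_unit_mult_left:
  assumes "inc_family le b"
  shows "inc_mult le (inc_unit le) b = b"
proof (intro ext)
  fix v w
  show "inc_mult le (inc_unit le) b v w = b v w"
  proof (cases "le v w")
    case False
    then show ?thesis using assms by (simp add: inc_mult_def inc_family_def)
  next
    case True
    have "inc_mult le (inc_unit le) b v w = (\<Sum>u\<in>{u. le v u \<and> le u w}. if u = v then b v w else 0)"
      using True le_refl_left[OF True] by (auto simp: inc_mult_def inc_unit_def intro!: sum.cong)
    also have "\<dots> = b v w"
      using True le_refl_left[OF True] finite_interval by (simp add: sum.delta)
    finally show ?thesis .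
  qed
qed

lemma inc_unit_mult_right:
  assumes "inc_family le b"
  shows "inc_mult le b (inc_unit le) = b"
proof (intro ext)
  fix v w
  show "inc_mult le b (inc_unit le) v w = b v w"
  proof (cases "le v w")
    case False
    then show ?thesis using assms by (simp add: inc_mult_def inc_family_def)
  next
    case True
    have "inc_mult le b (inc_unit le) v w = (\<Sum>u\<in>{u. le v u \<and> le u w}. if u = w then b v w else 0)"
      using True le_refl_right[OF True] by (auto simp: inc_mult_def inc_unit_def intro!: sum.cong)
    also have "\<dots> = b v w"
      using True le_refl_right[OF True] finite_interval by (simp add: sum.delta)
    finally show ?thesis .
  qed
qed

text \<open>With \<open>c = b * a\<close> one has \<open>c * b = b\<close>; as the diagonal of \<open>b\<close> is cancellable, this
  determines the entries of \<open>c\<close> by induction on the size of the interval.\<close>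

lemma left_inverse_of_right_inverse:
  assumes b: "inc_family le b" and ab: "inc_mult le a b = inc_unit le"
    and diag: "\<And>w. le w w \<Longrightarrow> b w w \<noteq> 0"
  shows "inc_mult le b a = inc_unit le"
proof (intro ext)
  define c where "c = inc_mult le b a"
  have cb: "inc_mult le c b = b"
    unfolding c_def inc_mult_assoc ab using b by (rule inc_unit_mult_right)
  fix v w
  have "c v w = inc_unit le v w"
  proof (induction "card {u. le v u \<and> le u w}" arbitrary: w rule: less_induct)
    case less
    show ?case
    proof (cases "le v w")
      case False
      then show ?thesis by (simp add: c_def inc_mult_def inc_unit_def)
    next
      case True
      let ?I = "{u. le v u \<and> le u w}"
      have wI: "w \<in> ?I" using True le_refl_right by blast
      have IH: "c v u = inc_unit le v u" if "u \<in> ?I" "u \<noteq> w" for u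
      proof (rule less.hyps, rule psubset_card_mono[OF finite_interval])
        have "w \<notin> {t. le v t \<and> le t u}" using that le_antisymmetric by blast
        moreover have "{t. le v t \<and> le t u} \<subseteq> ?I" using that le_transitive by blast
        ultimately show "{t. le v t \<and> le t u} \<subset> ?I" using wI by blast
      qed
      have "0 = inc_mult le c b v w - inc_mult le (inc_unit le) b v w"
        unfolding cb inc_unit_mult_left[OF b] by simp
      also have "\<dots> = (\<Sum>u\<in>?I. (c v u - inc_unit le v u) * b u w)"
        using True by (simp add: inc_mult_def sum_subtractf left_diff_distrib)
      also have "\<dots> = (\<Sum>u\<in>?I. if u = w then (c v w - inc_unit le v w) * b w w else 0)"
        using IH by (intro sum.cong) auto
      also have "\<dots> = (c v w - inc_unit le v w) * b w w"
        using wI finite_interval by (simp add: sum.delta)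
      finally have "(c v w - inc_unit le v w) * b w w = 0" by simp
      then show ?thesis using diag[of w] wI le_refl_right True by auto
    qed
  qed
  then show "inc_mult le b a v w = inc_unit le v w" by (simp add: c_def)
qed

lemma inc_inverse_eqI:
  assumes b: "inc_family le b" and ab: "inc_mult le a b = inc_unit le"
    and diag: "\<And>w. le w w \<Longrightarrow> b w w \<noteq> 0"
  shows "inc_inverse le a = b"
  unfolding inc_inverse_def
proof (rule the_equality)
  show "inc_family le b \<and> inc_mult le a b = inc_unit le \<and> inc_mult le b a = inc_unit le"
    using assms left_inverse_of_right_inverse by blast
  fix b' assume b': "inc_family le b' \<and> inc_mult le a b' = inc_unit le \<and> inc_mult le b' a = inc_unit le"
  then have "b' = inc_mult le b' (inc_mult le a b)" using ab inc_unit_mult_right by simp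
  also have "\<dots> = inc_mult le (inc_mult le b' a) b" by (rule inc_mult_assoc[symmetric])
  also have "\<dots> = b" using b' b inc_unit_mult_left by simp
  finally show "b' = b" .
qed

end

subsection \<open>The Chow polynomial as a sum over cellular strings\<close>

context stratified_polytope
begin

sublocale incidence_order "vertex_le P l"
proof
  show "le v w \<Longrightarrow> le v v" "le v w \<Longrightarrow> le w w" for v w using le_refl le_vertex by blast+
  show "le u v \<Longrightarrow> le v w \<Longrightarrow> le u w" for u v w by (rule le_trans)
  show "le v w \<Longrightarrow> le w v \<Longrightarrow> v = w" for v w
    using le_imp_l_less[of v w] le_imp_l_le[of w v] by force
  show "finite {u. le v u \<and> le u w}" for v w
    by (rule finite_subset[OF _ finite_vertices[OF polytope_P]]) (use le_vertex in blast)
qed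

definition string_poly :: "'a \<Rightarrow> 'a \<Rightarrow> int poly" where
  "string_poly v w = (\<Sum>Fs\<in>{Fs. cstring v w Fs}. [:-1, 1:] ^ string_dim Fs)"

lemma finite_faces_between: "finite (faces_between P l v w)"
  by (rule finite_subset[OF _ finite_polytope_faces[OF polytope_P]]) (auto simp: faces_between_def)

text \<open>A face with distinct ends has dimension at least 1, so each summand of the kernel
  contains the factor \<open>[:-1, 1:]\<close> and the division is exact.\<close>

lemma reduced_kappa_eq:
  assumes "le v u" "v \<noteq> u"
  shows "reduced_kappa P l v u = (\<Sum>F\<in>faces_between P l v u. [:-1, 1:] ^ (nat (aff_dim F) - 1))"
proof -
  have "[:-1, 1::int:] ^ nat (aff_dim F) = [:-1, 1:] * [:-1, 1:] ^ (nat (aff_dim F) - 1)"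
    if F: "F \<in> faces_between P l v u" for F
  proof -
    have "F \<noteq> {}" using F by (auto simp: faces_between_def)
    then have "nat (aff_dim F) = Suc (nat (aff_dim F) - 1)"
      using dim_level_dirs[OF assms F] by (simp add: aff_dim_dirs)
    then show ?thesis by (metis power_Suc)
  qed
  then have kappa: "kappa P l v u = [:-1, 1:] * (\<Sum>F\<in>faces_between P l v u. [:-1, 1:] ^ (nat (aff_dim F) - 1))"
    by (simp add: kappa_def sum_distrib_left)
  show ?thesis
    unfolding reduced_kappa_def kappa using assms by (subst nonzero_mult_div_cancel_left) auto
qed

text \<open>Split off the first cell. Its end \<open>u\<close> is determined by the cell, so every
  string is counted once, and the cell contributes its term of the reduced kernel.\<close>

lemma string_poly_rec:
  assumes "v \<noteq> w"
  shows "string_poly v w =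
    (\<Sum>u\<in>{u. le v u \<and> le u w} - {v}. reduced_kappa P l v u * string_poly u w)"
proof -
  let ?I = "{u. le v u \<and> le u w} - {v}"
  let ?X = "[:-1, 1:] :: int poly"
  let ?T = "SIGMA u:?I. faces_between P l v u \<times> {Fs. cstring u w Fs}"
  have image: "{Fs. cstring v w Fs} = (\<lambda>(u, F, Fs). F # Fs) ` ?T"
  proof
    show "{Fs. cstring v w Fs} \<subseteq> (\<lambda>(u, F, Fs). F # Fs) ` ?T"
    proof
      fix Gs assume "Gs \<in> {Fs. cstring v w Fs}"
      then obtain F Fs where Gs: "Gs = F # Fs" "cstring v w (F # Fs)" using assms by (cases Gs) auto
      then obtain u where "le v u" "u \<noteq> v" "F \<in> faces_between P l v u" "cstring u w Fs" by auto
      then have "(u, F, Fs) \<in> ?T" using cstring_le by auto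
      then show "Gs \<in> (\<lambda>(u, F, Fs). F # Fs) ` ?T" using Gs by force
    qed
  qed auto
  have inj: "inj_on (\<lambda>(u, F, Fs). F # Fs) ?T"
    by (auto simp: inj_on_def dest: faces_between_ends_unique)
  have "string_poly v w = (\<Sum>(u, F, Fs)\<in>?T. ?X ^ string_dim (F # Fs))"
    unfolding string_poly_def image by (subst sum.reindex[OF inj]) (simp add: case_prod_unfold)
  also have "\<dots> = (\<Sum>u\<in>?I. \<Sum>(F, Fs)\<in>faces_between P l v u \<times> {Fs. cstring u w Fs}. ?X ^ string_dim (F # Fs))"
    using finite_interval finite_faces_between finite_cstrings
    by (subst sum.Sigma) (auto simp: case_prod_unfold)
  also have "\<dots> = (\<Sum>u\<in>?I. reduced_kappa P l v u * string_poly u w)"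
  proof (rule sum.cong[OF refl])
    fix u assume u: "u \<in> ?I"
    then have vu: "le v u" "v \<noteq> u" by auto
    have "(\<Sum>(F, Fs)\<in>faces_between P l v u \<times> {Fs. cstring u w Fs}. ?X ^ string_dim (F # Fs)) =
        (\<Sum>F\<in>faces_between P l v u. \<Sum>Fs\<in>{Fs. cstring u w Fs}. ?X ^ (nat (aff_dim F) - 1) * ?X ^ string_dim Fs)"
      by (simp add: sum.cartesian_product string_dim_def power_add)
    also have "\<dots> = reduced_kappa P l v u * string_poly u w"
      unfolding reduced_kappa_eq[OF vu] string_poly_def sum_product ..
    finally show "(\<Sum>(F, Fs)\<in>faces_between P l v u \<times> {Fs. cstring u w Fs}. ?X ^ string_dim (F # Fs)) =
        reduced_kappa P l v u * string_poly u w" .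
  qed
  finally show ?thesis .
qed

lemma string_poly_self: "v extreme_point_of P \<Longrightarrow> string_poly v v = 1"
  by (simp add: string_poly_def cstring_self string_dim_def)

text \<open>The diagonal value -1 of the reduced kernel isolates the term at \<open>u = v\<close>,
  and \<open>string_poly_rec\<close> says that the other terms cancel it. So the negated string
  polynomials are a right inverse, which \<open>inc_inverse_eqI\<close> identifies with the
  two-sided one.\<close>

lemma chow_poly_eq: "chow_poly P l v w = string_poly v w"
proof -
  have "inc_inverse le (reduced_kappa P l) = (\<lambda>v w. - string_poly v w)"
  proof (rule inc_inverse_eqI)
    show "inc_family le (\<lambda>v w. - string_poly v w)"
      unfolding inc_family_def
    proof (intro allI impI)
      fix v w assume "\<not> le v w"
      then have "{Fs. cstring v w Fs} = {}" using cstring_le by blast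
      then show "- string_poly v w = 0" by (simp add: string_poly_def)
    qed
    show "- string_poly w w \<noteq> 0" if "le w w" for w
      using string_poly_self le_vertex(1)[OF that] by simp
    show "inc_mult le (reduced_kappa P l) (\<lambda>v w. - string_poly v w) = inc_unit le"
    proof (intro ext)
      fix v w
      show "inc_mult le (reduced_kappa P l) (\<lambda>v w. - string_poly v w) v w = inc_unit le v w"
      proof (cases "le v w")
        case False
        then show ?thesis by (simp add: inc_mult_def inc_unit_def)
      next
        case True
        let ?I = "{u. le v u \<and> le u w}"
        have v: "v extreme_point_of P" "le v v" "v \<in> ?I" using True le_vertex le_refl by blast+
        have rv: "reduced_kappa P l v v = -1" using v by (simp add: reduced_kappa_def)
        have "inc_mult le (reduced_kappa P l) (\<lambda>v w. - string_poly v w) v w =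
            - (\<Sum>u\<in>?I. reduced_kappa P l v u * string_poly u w)"
          using True by (simp add: inc_mult_def sum_negf)
        also have "(\<Sum>u\<in>?I. reduced_kappa P l v u * string_poly u w) =
            - string_poly v w + (\<Sum>u\<in>?I - {v}. reduced_kappa P l v u * string_poly u w)"
          using sum.remove[OF finite_interval v(3), of "\<lambda>u. reduced_kappa P l v u * string_poly u w"] rv by simp
        finally have eq: "inc_mult le (reduced_kappa P l) (\<lambda>v w. - string_poly v w) v w =
            string_poly v w - (\<Sum>u\<in>?I - {v}. reduced_kappa P l v u * string_poly u w)" by simp
        show ?thesis
        proof (cases "v = w")
          case True
          have "(\<Sum>u\<in>?I - {v}. reduced_kappa P l v u * string_poly u w) = 0"
            by (intro sum.neutral) (use True le_antisymmetric in blast)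
          then show ?thesis using eq True v string_poly_self by (simp add: inc_unit_def)
        next
          case False
          then show ?thesis using eq string_poly_rec[OF False] by (simp add: inc_unit_def)
        qed
      qed
    qed
  qed
  then show ?thesis by (simp add: chow_poly_def)
qed

end

subsection \<open>Face numbers of dual polytopes\<close>

text \<open>A nonempty \<open>A\<close> lies in a facet of \<open>B\<close>, which must then be
  \<open>A\<close> itself. If \<open>A\<close> is empty, \<open>B\<close> can only be a vertex,
  which fits the dimension -1 of the empty face.\<close>

lemma face_cover_aff_dim:
  fixes S :: "'a::euclidean_space set"
  assumes S: "polytope S" and AB: "A face_of S" "B face_of S" "A \<subset> B"
    and cover: "\<And>G. G face_of S \<Longrightarrow> A \<subseteq> G \<Longrightarrow> G \<subseteq> B \<Longrightarrow> G = A \<or> G = B"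
  shows "aff_dim B = aff_dim A + 1"
proof -
  have B: "polytope B" using S AB face_of_polytope_polytope by blast
  show ?thesis
  proof (cases "A = {}")
    case True
    obtain x where x: "x extreme_point_of B" using polytope_vertex_exists[OF B] AB by blast
    then have "{x} face_of B" by (simp add: face_of_singleton)
    then have "{x} face_of S" "{x} \<subseteq> B" using AB(2) face_of_trans face_of_imp_subset by blast+
    then have "B = {x}" using cover[of "{x}"] True by auto
    then show ?thesis using True by simp
  next
    case False
    have "A face_of B" using AB face_of_face by blast
    then obtain G where G: "G facet_of B" "A \<subseteq> G"
      using face_of_polyhedron_subset_facet[of B A] polytope_imp_polyhedron[OF B] False AB(3) by blast
    have "G face_of B" using G(1) by (rule facet_of_imp_face_of)
    then have "G face_of S" "G \<subseteq> B" using AB(2) face_of_trans face_of_imp_subset by blast+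
    moreover have "G \<noteq> B" using G(1) by auto
    ultimately have "G = A" using cover G(2) by blast
    then show ?thesis using G(1) by (simp add: facet_of_def)
  qed
qed

lemma face_cover_exists:
  fixes S :: "'a::euclidean_space set"
  assumes S: "polytope S" and A: "A face_of S" "A \<noteq> S"
  obtains B where "B face_of S" "A \<subset> B"
    "\<And>G. G face_of S \<Longrightarrow> A \<subseteq> G \<Longrightarrow> G \<subseteq> B \<Longrightarrow> G = A \<or> G = B"
proof -
  let ?K = "{B. B face_of S \<and> A \<subset> B}"
  have fin: "finite ?K" using finite_polytope_faces[OF S] by simp
  have "S \<in> ?K"
    using A(2) face_of_imp_subset[OF A(1)] face_of_refl[OF polytope_imp_convex[OF S]] by auto
  then have "?K \<noteq> {}" by auto
  then have "\<exists>B\<in>?K. \<forall>G\<in>?K. G \<subseteq> B \<longrightarrow> B = G"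
    by (rule finite_has_minimal[OF fin])
  then obtain B where B: "B face_of S" "A \<subset> B"
    "\<And>G. G face_of S \<Longrightarrow> A \<subset> G \<Longrightarrow> G \<subseteq> B \<Longrightarrow> B = G"
    by auto
  show thesis
    by (rule that[OF B(1,2)]) (use B(3) in blast)
qed

text \<open>Order reversal maps covers to covers, and by \<open>face_cover_aff_dim\<close> each
  cover changes the dimension by 1. The descent starts at \<open>C\<close>, whose image is the empty
  face, of dimension -1.\<close>

lemma dual_face_aff_dim:
  fixes C :: "'a::euclidean_space set" and R :: "'b::euclidean_space set"
  assumes C: "polytope C" and R: "polytope R"
    and bij: "bij_betw \<phi> {F. F face_of C} {G. G face_of R}"
    and anti: "\<forall>F G. F face_of C \<longrightarrow> G face_of C \<longrightarrow> (F \<subseteq> G \<longleftrightarrow> \<phi> G \<subseteq> \<phi> F)"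
  shows "F face_of C \<Longrightarrow> aff_dim (\<phi> F) = aff_dim C - 1 - aff_dim F"
proof (induction "nat (aff_dim C - aff_dim F)" arbitrary: F rule: less_induct)
  case less
  have face: "\<phi> F face_of R" if "F face_of C" for F using bij_betw_apply[OF bij] that by simp
  have surj: "\<exists>F. F face_of C \<and> \<phi> F = G" if "G face_of R" for G
  proof -
    have "G \<in> \<phi> ` {F. F face_of C}" using bij_betw_imp_surj_on[OF bij] that by simp
    then show ?thesis by auto
  qed
  have CC: "C face_of C" using C polytope_imp_convex face_of_refl by blast
  show ?case
  proof (cases "F = C")
    case True
    obtain F0 where F0: "F0 face_of C" "\<phi> F0 = {}" using surj[of "{}"] by auto
    then have "\<phi> C \<subseteq> {}" using anti[rule_format, OF F0(1) CC] face_of_imp_subset by blast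
    then show ?thesis using True by simp
  next
    case False
    obtain B where B: "B face_of C" "F \<subset> B"
      "\<And>G. G face_of C \<Longrightarrow> F \<subseteq> G \<Longrightarrow> G \<subseteq> B \<Longrightarrow> G = F \<or> G = B"
      using face_cover_exists[OF C less.prems False] by blast
    have dB: "aff_dim B = aff_dim F + 1" using face_cover_aff_dim[OF C less.prems B] by blast
    have "aff_dim B \<le> aff_dim C" using B(1) face_of_imp_subset aff_dim_subset by blast
    then have IH: "aff_dim (\<phi> B) = aff_dim C - 1 - aff_dim B"
      using dB by (intro less.hyps B(1)) linarith
    have "aff_dim (\<phi> F) = aff_dim (\<phi> B) + 1"
    proof (rule face_cover_aff_dim[OF R face[OF B(1)] face[OF less.prems]])
      show "\<phi> B \<subset> \<phi> F"
        using anti[rule_format, OF less.prems B(1)] anti[rule_format, OF B(1) less.prems] B(2) by blast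
      fix G assume G: "G face_of R" "\<phi> B \<subseteq> G" "G \<subseteq> \<phi> F"
      obtain H where H: "H face_of C" "\<phi> H = G" using surj G(1) by blast
      then have "F \<subseteq> H" "H \<subseteq> B" using anti less.prems B(1) G by blast+
      then show "G = \<phi> B \<or> G = \<phi> F" using B(3)[OF H(1)] H(2) by blast
    qed
    then show ?thesis using IH dB by simp
  qed
qed

lemma h_poly_dual:
  fixes C :: "'a::euclidean_space set" and R :: "'b::euclidean_space set"
  assumes C: "polytope C" "C \<noteq> {}" and dual: "dual_polytope_of R C"
  shows "h_poly R = (\<Sum>i=0..nat (aff_dim C). of_nat (num_faces C (int i)) * [:-1, 1:] ^ i)"
proof -
  obtain \<phi> where R: "polytope R" and bij: "bij_betw \<phi> {F. F face_of C} {G. G face_of R}"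
    and anti: "\<forall>F G. F face_of C \<longrightarrow> G face_of C \<longrightarrow> (F \<subseteq> G \<longleftrightarrow> \<phi> G \<subseteq> \<phi> F)"
    using dual unfolding dual_polytope_of_def by blast
  note dim = dual_face_aff_dim[OF C(1) R bij anti]
  have face: "\<phi> F face_of R" if "F face_of C" for F using bij_betw_apply[OF bij] that by simp
  have surj: "\<exists>F. F face_of C \<and> \<phi> F = G" if "G face_of R" for G
  proof -
    have "G \<in> \<phi> ` {F. F face_of C}" using bij_betw_imp_surj_on[OF bij] that by simp
    then show ?thesis by auto
  qed
  have "R face_of R" using R polytope_imp_convex face_of_refl by blast
  then obtain F0 where F0: "F0 face_of C" "\<phi> F0 = R" using surj by blast
  \<comment> \<open>The empty face, of dimension -1, corresponds to all of \<open>R\<close>, so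
    \<open>R\<close> and \<open>C\<close> have the same dimension.\<close>
  have "\<phi> {} face_of R" using face by simp
  then have "\<phi> {} = R" using anti[rule_format, OF empty_face_of F0(1)] F0(2) face_of_imp_subset by blast
  then have dR: "aff_dim R = aff_dim C" using dim[OF empty_face_of] by simp
  have "\<not> aff_dim C < 0" using C(2) by simp
  then obtain n where n: "aff_dim C = int n" by (metis linorder_not_less nonneg_int_cases)
  \<comment> \<open>Faces of \<open>R\<close> of dimension \<open>i - 1\<close> correspond to faces
    of \<open>C\<close> of dimension \<open>n - i\<close>, in particular the empty face of
    \<open>R\<close> to \<open>C\<close> itself. So the exponent in the h-polynomial is the
    dimension of the corresponding face of \<open>C\<close>.\<close>
  have num: "num_faces R (int i - 1) = num_faces C (int (n - i))" if "i \<le> n" for i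
  proof -
    have image: "\<phi> ` {F. F face_of C \<and> aff_dim F = int (n - i)} = {G. G face_of R \<and> aff_dim G = int i - 1}"
    proof (intro subset_antisym subsetI)
      fix G assume "G \<in> \<phi> ` {F. F face_of C \<and> aff_dim F = int (n - i)}"
      then show "G \<in> {G. G face_of R \<and> aff_dim G = int i - 1}"
        using dim n \<open>i \<le> n\<close> face by auto
    next
      fix G assume G: "G \<in> {G. G face_of R \<and> aff_dim G = int i - 1}"
      then obtain F where "F face_of C" "\<phi> F = G" using surj by blast
      then show "G \<in> \<phi> ` {F. F face_of C \<and> aff_dim F = int (n - i)}"
        using dim[of F] G n \<open>i \<le> n\<close> by (intro image_eqI[of _ _ F]) auto
    qed
    have inj: "inj_on \<phi> {F. F face_of C \<and> aff_dim F = int (n - i)}"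
      by (rule inj_on_subset[OF bij_betw_imp_inj_on[OF bij]]) auto
    show ?thesis using card_image[OF inj] unfolding image num_faces_def .
  qed
  have "h_poly R = (\<Sum>i=0..n. of_nat (num_faces R (int i - 1)) * [:-1, 1:] ^ (n - i))"
    using dR n by (simp add: h_poly_def)
  also have "\<dots> = (\<Sum>i=0..n. of_nat (num_faces C (int (n - i))) * [:-1, 1:] ^ (n - i))"
    using num by (intro sum.cong) auto
  also have "\<dots> = (\<Sum>i=0..n. of_nat (num_faces C (int i)) * [:-1, 1:] ^ i)"
    by (subst (2) sum.atLeastAtMost_rev) simp
  finally show ?thesis using n by simp
qed

theorem theorem4p13:
  fixes P :: "'a::euclidean_space set" and l :: "'a \<Rightarrow> real" and v w :: 'a
  assumes "polytope P"
    and "linear l"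
    and "\<And>E. E edge_of P \<Longrightarrow> \<not> l constant_on E"
    and "\<And>u. u extreme_point_of P \<Longrightarrow> Fminus P l u face_of P"
    and "\<And>u. u extreme_point_of P \<Longrightarrow> Fplus P l u face_of P"
    and "Ominus_stratification P l"
    and "vertex_le P l v w"
  defines "C \<equiv> monotone_path_polytope l (Fplus P l v \<inter> Fminus P l w)"
  shows "(\<forall>R :: 'b::euclidean_space set. dual_polytope_of R C \<longrightarrow> chow_poly P l v w = h_poly R) \<and>
         chow_poly P l v w =
           (\<Sum>i=0..nat (aff_dim C). of_nat (num_faces C (int i)) * [:-1, 1:] ^ i)"
proof -
  interpret stratified_polytope P l
    using assms(1-6) by (rule stratified_polytope.intro)
  have C: "C = monotone_path_polytope l (Q v w)" by (simp add: C_def Q_def)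
  have "polytope C" "C \<noteq> {}"
    unfolding C using assms(7) polytope_monotone_path_polytope monotone_path_polytope_nonempty by blast+
  moreover have "chow_poly P l v w =
      (\<Sum>i=0..nat (aff_dim C). of_nat (num_faces C (int i)) * [:-1, 1:] ^ i)"
    unfolding C face_sum_monotone_path_polytope[OF assms(7)] chow_poly_eq string_poly_def ..
  moreover have "h_poly R = (\<Sum>i=0..nat (aff_dim C). of_nat (num_faces C (int i)) * [:-1, 1:] ^ i)"
    if "dual_polytope_of R C" for R :: "'b set"
    by (rule h_poly_dual) fact+
  ultimately show ?thesis by simp
qed

end
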